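(* Let $p_1,p_2$ be monic complex polynomials of degrees $d_1,d_2$ with distinct roots $\Lambda_1=\{\lambda_1,\dots,\lambda_{d_1}\}$ and $\Lambda_2=\{\mu_1,\dots,\mu_{d_2}\}$, let $M_1,M_2\subset\mathbb{C}$ be compact, let $K_i=p_i^{-1}(M_i)$ for $i=1,2$, and let $X=C_{\Lambda_1\times\Lambda_2}(M_1\times M_2)$. For $(z_1,z_2)\in K_1\times K_2$ let $$\chi_{(z_1,z_2)}(f)=\sum_{j=1}^{d_1}\sum_{k=1}^{d_2}\delta_{1,j}(z_1)\,\delta_{2,k}(z_2)\,f_{j,k}(p_1(z_1),p_2(z_2)),\qquad f\in X.$$ Then $(z_1,z_2)\mapsto\chi_{(z_1,z_2)}$ is a bijection from $K_1\times K_2$ onto the set of characters of $X$. Under the resulting identification of the set of characters with $K_1\times K_2$, the Gelfand transform $\hat f$ of each $f\in X$ is the function $\mathcal{L}f:K_1\times K_2\to\mathbb{C}$, and the spectrum of $f$ in $X$ is $$\sigma(f)=\{\hat f(z_1,z_2):(z_1,z_2)\in K_1\times K_2\}.$$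
   Context: $\delta_{1,j}(z)=\frac{p_1(z)}{p_1'(\lambda_j)(z-\lambda_j)}$ and $\delta_{2,k}(z)=\frac{p_2(z)}{p_2'(\mu_k)(z-\mu_k)}$ are the Lagrange interpolation polynomials at the roots of $p_1$ and of $p_2$. The multicentric representation operator $\mathcal{L}$ sends $f:M_1\times M_2\to\mathbb{C}^{d_1\times d_2}$ to the scalar function $(\mathcal{L}f)(z_1,z_2)=\sum_{j=1}^{d_1}\sum_{k=1}^{d_2}\delta_{1,j}(z_1)\delta_{2,k}(z_2)f_{j,k}(p_1(z_1),p_2(z_2))$ on $K_1\times K_2$. Put $\sigma_{1,jl}=\frac{1}{p_1'(\lambda_l)}\frac{1}{\lambda_j-\lambda_l}$ for $j\ne l$ and $\sigma_{2,km}=\frac{1}{p_2'(\mu_m)}\frac{1}{\mu_k-\mu_m}$ for $k\neq m$. For functions $f,g: M_1\times M_2\to\mathbb{C}^{d_1\times d_2}$ with components $f_{j,k},g_{j,k}$, the polyproduct $f\circledcirc g$ is defined at each $(w_1,w_2)$ by $$(f\circledcirc g)_{j,k}=f_{j,k}g_{j,k}-w_1\sum_{l\ne j}\sigma_{1,jl}(f_{j,k}-f_{l,k})(g_{j,k}-g_{l,k})-w_2\sum_{m\neq k}\sigma_{2,km}(f_{j,k}-f_{j,m})(g_{j,k}-g_{j,m})$$ $$\quad+w_1w_2\sum_{l\ne j,\,m\ne k}\sigma_{1,jl}\sigma_{2,km}\big((f_{j,k}-f_{j,m})-(f_{l,k}-f_{l,m})\big)\big((g_{j,k}-g_{j,m})-(g_{l,k}-g_{l,m})\big),$$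 where all components are evaluated at $(w_1,w_2)$. $C_{\Lambda_1\times\Lambda_2}(M_1\times M_2)$ denotes the space $C(M_1\times M_2,\mathbb{C}^{d_1\times d_2})$ of continuous functions with product $\circledcirc$ and norm $\|f\|=\sup_{|g|_\infty\le1}|f\circledcirc g|_\infty$, where $|f|_\infty=\max_{j,k}\max_{M_1\times M_2}|f_{j,k}|$; it is a commutative unital Banach algebra whose unit is the constant function with all components equal to $1$. A character is a nonzero multiplicative linear functional $X\to\mathbb{C}$; the Gelfand transform of $f$ is the function $\eta\mapsto\eta(f)$ on the set of characters. *)

theory Defs
  imports "HOL-Analysis.Analysis" "HOL-Algebra.Module" "HOL-Computational_Algebra.Polynomial"
begin

(* A function on a set S is represented by its extensional representative (FuncSet), so that
   equality of HOL functions is equality of functions on S. This applies to the elements of the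
   algebra, to characters, to the Gelfand transform and to the multicentric representation. *)

record 'b normed_algebra = "(complex, 'b) module" +
  alg_norm :: "'b \<Rightarrow> real"

definition characters :: "(complex, 'b, 'm) module_scheme \<Rightarrow> ('b \<Rightarrow> complex) set" where
  "characters A = {\<eta> \<in> extensional (carrier A).
     (\<forall>f\<in>carrier A. \<forall>g\<in>carrier A. \<eta> (f \<oplus>\<^bsub>A\<^esub> g) = \<eta> f + \<eta> g) \<and>
     (\<forall>c. \<forall>f\<in>carrier A. \<eta> (c \<odot>\<^bsub>A\<^esub> f) = c * \<eta> f) \<and>
     (\<forall>f\<in>carrier A. \<forall>g\<in>carrier A. \<eta> (f \<otimes>\<^bsub>A\<^esub> g) = \<eta> f * \<eta> g) \<and>
     (\<exists>f\<in>carrier A. \<eta> f \<noteq> 0)}"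

definition gelfand_transform ::
  "(complex, 'b, 'm) module_scheme \<Rightarrow> 'b \<Rightarrow> ('b \<Rightarrow> complex) \<Rightarrow> complex" where
  "gelfand_transform A f = (\<lambda>\<eta>\<in>characters A. \<eta> f)"

definition spectrum :: "(complex, 'b, 'm) module_scheme \<Rightarrow> 'b \<Rightarrow> complex set" where
  "spectrum A f = {c. f \<ominus>\<^bsub>A\<^esub> (c \<odot>\<^bsub>A\<^esub> \<one>\<^bsub>A\<^esub>) \<notin> Units A}"

(* Stated with polynomial division: the pointwise quotient p(z) / (p'(a) (z - a)) would
   evaluate to 0 instead of 1 at z = a. *)
definition lagrange_poly :: "complex poly \<Rightarrow> complex \<Rightarrow> complex poly" where
  "lagrange_poly p a = Polynomial.smult (1 / poly (pderiv p) a) (p div [:- a, 1:])"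

lemma poly_lagrange_poly_other:
  assumes "poly p a = 0" "z \<noteq> a"
  shows "poly (lagrange_poly p a) z = poly p z / (poly (pderiv p) a * (z - a))"
proof -
  obtain q where q: "p = [:- a, 1:] * q"
    using assms(1) by (auto simp: poly_eq_0_iff_dvd)
  have "p div [:- a, 1:] = q"
    unfolding q by (rule nonzero_mult_div_cancel_left) simp
  moreover have "poly p z = (z - a) * poly q z"
    unfolding q by (simp add: algebra_simps)
  ultimately show ?thesis
    using assms(2) by (simp add: lagrange_poly_def)
qed

lemma poly_lagrange_poly_self:
  assumes "poly p a = 0" "poly (pderiv p) a \<noteq> 0"
  shows "poly (lagrange_poly p a) a = 1"
proof -
  obtain q where q: "p = [:- a, 1:] * q"
    using assms(1) by (auto simp: poly_eq_0_iff_dvd)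
  have "p div [:- a, 1:] = q"
    unfolding q by (rule nonzero_mult_div_cancel_left) simp
  moreover have "poly (pderiv p) a = poly q a"
    unfolding q pderiv_mult by (simp add: pderiv_pCons)
  ultimately show ?thesis
    using assms(2) by (simp add: lagrange_poly_def)
qed

definition multicentric_sum ::
  "complex poly \<Rightarrow> complex poly \<Rightarrow> ('d1::finite \<Rightarrow> complex) \<Rightarrow> ('d2::finite \<Rightarrow> complex) \<Rightarrow>
   (complex \<times> complex \<Rightarrow> complex^'d2^'d1) \<Rightarrow> complex \<times> complex \<Rightarrow> complex" where
  "multicentric_sum p1 p2 lam mu f = (\<lambda>(z1, z2).
     \<Sum>j\<in>UNIV. \<Sum>k\<in>UNIV.
       poly (lagrange_poly p1 (lam j)) z1 * poly (lagrange_poly p2 (mu k)) z2 *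
       f (poly p1 z1, poly p2 z2) $ j $ k)"

definition multicentric_rep ::
  "complex poly \<Rightarrow> complex poly \<Rightarrow> ('d1::finite \<Rightarrow> complex) \<Rightarrow> ('d2::finite \<Rightarrow> complex) \<Rightarrow>
   complex set \<Rightarrow> complex set \<Rightarrow>
   (complex \<times> complex \<Rightarrow> complex^'d2^'d1) \<Rightarrow> complex \<times> complex \<Rightarrow> complex" where
  "multicentric_rep p1 p2 lam mu M1 M2 f =
     restrict (multicentric_sum p1 p2 lam mu f) ((poly p1 -` M1) \<times> (poly p2 -` M2))"

definition sigma_coeff :: "complex poly \<Rightarrow> ('d::finite \<Rightarrow> complex) \<Rightarrow> 'd \<Rightarrow> 'd \<Rightarrow> complex" where
  "sigma_coeff p \<rho> j l = 1 / poly (pderiv p) (\<rho> l) * (1 / (\<rho> j - \<rho> l))"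

definition polyproduct ::
  "complex poly \<Rightarrow> complex poly \<Rightarrow> ('d1::finite \<Rightarrow> complex) \<Rightarrow> ('d2::finite \<Rightarrow> complex) \<Rightarrow>
   (complex \<times> complex \<Rightarrow> complex^'d2^'d1) \<Rightarrow> (complex \<times> complex \<Rightarrow> complex^'d2^'d1) \<Rightarrow>
   complex \<times> complex \<Rightarrow> complex^'d2^'d1" where
  "polyproduct p1 p2 lam mu f g = (\<lambda>(w1, w2).
     let F = (\<lambda>j k. f (w1, w2) $ j $ k);
         G = (\<lambda>j k. g (w1, w2) $ j $ k);
         \<sigma>1 = sigma_coeff p1 lam;
         \<sigma>2 = sigma_coeff p2 mu
     in \<chi> j k.
       F j k * G j k
       - w1 * (\<Sum>l\<in>UNIV - {j}. \<sigma>1 j l * (F j k - F l k) * (G j k - G l k))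
       - w2 * (\<Sum>m\<in>UNIV - {k}. \<sigma>2 k m * (F j k - F j m) * (G j k - G j m))
       + w1 * w2 * (\<Sum>l\<in>UNIV - {j}. \<Sum>m\<in>UNIV - {k}. \<sigma>1 j l * \<sigma>2 k m *
           ((F j k - F j m) - (F l k - F l m)) * ((G j k - G j m) - (G l k - G l m))))"

definition max_norm :: "complex set \<Rightarrow> complex set \<Rightarrow>
   (complex \<times> complex \<Rightarrow> complex^'d2::finite^'d1::finite) \<Rightarrow> real" where
  "max_norm M1 M2 f = (MAX j\<in>UNIV. MAX k\<in>UNIV. SUP w\<in>M1 \<times> M2. cmod (f w $ j $ k))"

definition cont_functions :: "complex set \<Rightarrow> complex set \<Rightarrow>
   (complex \<times> complex \<Rightarrow> complex^'d2::finite^'d1::finite) set" where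
  "cont_functions M1 M2 = {f \<in> extensional (M1 \<times> M2). continuous_on (M1 \<times> M2) f}"

definition polyproduct_algebra ::
  "complex poly \<Rightarrow> complex poly \<Rightarrow> ('d1::finite \<Rightarrow> complex) \<Rightarrow> ('d2::finite \<Rightarrow> complex) \<Rightarrow>
   complex set \<Rightarrow> complex set \<Rightarrow> (complex \<times> complex \<Rightarrow> complex^'d2^'d1) normed_algebra" where
  "polyproduct_algebra p1 p2 lam mu M1 M2 =
     \<lparr> carrier = cont_functions M1 M2,
       monoid.mult = (\<lambda>f g. restrict (polyproduct p1 p2 lam mu f g) (M1 \<times> M2)),
       one = (\<lambda>w\<in>M1 \<times> M2. \<chi> j k. 1),
       zero = (\<lambda>w\<in>M1 \<times> M2. 0),
       add = (\<lambda>f g. \<lambda>w\<in>M1 \<times> M2. f w + g w),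
       module.smult = (\<lambda>c f. \<lambda>w\<in>M1 \<times> M2. \<chi> j k. c * f w $ j $ k),
       alg_norm = (\<lambda>f. SUP g\<in>{g \<in> cont_functions M1 M2. max_norm M1 M2 g \<le> 1}.
                          max_norm M1 M2 (polyproduct p1 p2 lam mu f g)) \<rparr>"

definition point_character ::
  "complex poly \<Rightarrow> complex poly \<Rightarrow> ('d1::finite \<Rightarrow> complex) \<Rightarrow> ('d2::finite \<Rightarrow> complex) \<Rightarrow>
   complex set \<Rightarrow> complex set \<Rightarrow>
   complex \<times> complex \<Rightarrow> (complex \<times> complex \<Rightarrow> complex^'d2^'d1) \<Rightarrow> complex" where
  "point_character p1 p2 lam mu M1 M2 z =
     (\<lambda>f\<in>carrier (polyproduct_algebra p1 p2 lam mu M1 M2). multicentric_sum p1 p2 lam mu f z)"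

end

theory Submission
  imports Defs "HOL-Computational_Algebra.Fundamental_Theorem_Algebra"
begin

text \<open>For fixed \<open>w = (w1, w2)\<close> the polyproduct makes matrices into the tensor product of the algebras
  \<open>C[z] / (p1(z) - w1)\<close> and \<open>C[z] / (p2(z) - w2)\<close>, written in the Lagrange bases; the structure constants
  come from \<open>\<delta>\<^sub>j \<delta>\<^sub>l = p (\<sigma>\<^sub>j\<^sub>l \<delta>\<^sub>j + \<sigma>\<^sub>l\<^sub>j \<delta>\<^sub>l)\<close>. A character of \<open>X\<close> restricts on the scalar functions to evaluation at
  some \<open>w\<close> in \<open>M1 \<times> M2\<close>, and its values \<open>a\<^sub>j\<close> on the row units satisfy the relations of the \<open>\<delta>\<^sub>j\<close>,
  which force \<open>a\<^sub>j = \<delta>\<^sub>j(z)\<close> for a \<open>z\<close> with \<open>p1(z) = w1\<close>; likewise for the columns.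

  For the spectrum, multiplication by \<open>g(w)\<close> is a linear map whose determinant, at regular values \<open>w\<close>,
  is the product of the values of \<open>g(w)\<close> at the points above \<open>w\<close>. By approximation, a vanishing
  determinant at any \<open>w\<close> yields a point above \<open>w\<close> where \<open>g(w)\<close> vanishes. If there is no such point,
  Cramer's rule gives an inverse that is continuous in \<open>w\<close>.\<close>

section \<open>Lagrange interpolation at simple roots\<close>

lemma poly_zero_if_enough_roots:
  fixes q :: "'a::idom poly" and r :: "'d::finite \<Rightarrow> 'a"
  assumes "inj r" "\<And>i. poly q (r i) = 0" "degree q < CARD('d)"
  shows "q = 0"
proof (rule ccontr)
  assume q: "q \<noteq> 0"
  have "card (range r) \<le> card {x. poly q x = 0}"
    using poly_roots_finite[OF q] assms(2) by (intro card_mono) auto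
  also have "\<dots> \<le> degree q"
    using q by (rule card_poly_roots_bound)
  finally show False
    using assms(1,3) by (simp add: card_image)
qed

text \<open>A nonconstant polynomial tends to infinity. Hence the points above a convergent sequence
  of values stay bounded, and a limit point can be extracted from them.\<close>

lemma bounded_poly_vimage:
  fixes p :: "'a::{comm_semiring_0,real_normed_div_algebra} poly"
  assumes "degree p > 0" "bounded S"
  shows "bounded (poly p -` S)"
proof -
  obtain B where B: "\<And>x. x \<in> S \<Longrightarrow> norm x \<le> B"
    using assms(2) bounded_iff by blast
  obtain a q where p: "p = pCons a q" "q \<noteq> 0"
    using assms(1) by (cases p) (auto split: if_splits)
  obtain r where r: "\<And>z. r \<le> norm z \<Longrightarrow> B + 1 \<le> norm (poly p z)"
    using poly_infinity[OF p(2), of "B + 1" a] p(1) by blast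
  have "norm z \<le> r" if "poly p z \<in> S" for z
    using r[of z] B[OF that] by (cases "r \<le> norm z") auto
  then show ?thesis
    by (auto simp: bounded_iff)
qed

text \<open>As the \<open>e j\<close> sum to 1, the sum of \<open>e j * (x j * y j)\<close> exceeds
  the product by half of the double sum of \<open>e j * e l * (x j - x l) * (y j - y l)\<close>. The
  relation \<open>prod\<close> makes each term linear in \<open>e\<close>, and by symmetry its two
  halves have equal sums. The \<open>e j\<close> will be values of Lagrange polynomials, in one
  variable at a time.\<close>

lemma bilinear_sum_expand:
  fixes e x y :: "'d::finite \<Rightarrow> complex" and s :: "'d \<Rightarrow> 'd \<Rightarrow> complex"
  assumes one: "(\<Sum>j\<in>UNIV. e j) = 1"
    and prod: "\<And>j l. j \<noteq> l \<Longrightarrow> e j * e l = w * (s j l * e j + s l j * e l)"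
  shows "(\<Sum>j\<in>UNIV. e j * x j) * (\<Sum>j\<in>UNIV. e j * y j) =
    (\<Sum>j\<in>UNIV. e j * (x j * y j - w * (\<Sum>l\<in>UNIV - {j}. s j l * (x j - x l) * (y j - y l))))"
proof -
  define D where "D j l = (x j - x l) * (y j - y l)" for j l
  define A where "A = (\<Sum>j\<in>UNIV. \<Sum>l\<in>UNIV. e j * e l * (x j * y j - x j * y l))"
  define T where "T = (\<Sum>j\<in>UNIV. \<Sum>l\<in>UNIV. w * (s j l * e j) * D j l)"
  \<comment> \<open>\<open>A'\<close> and \<open>T'\<close> are \<open>A\<close> and
    \<open>T\<close> with the indices exchanged; adding both forms produces the symmetric factor
    \<open>D\<close>.\<close>
  have A': "A = (\<Sum>j\<in>UNIV. \<Sum>l\<in>UNIV. e j * e l * (x l * y l - x l * y j))"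
    unfolding A_def by (subst sum.swap) (simp add: mult.commute)
  have T': "T = (\<Sum>j\<in>UNIV. \<Sum>l\<in>UNIV. w * (s l j * e l) * D j l)"
    unfolding T_def D_def by (subst sum.swap) (intro sum.cong refl, simp add: algebra_simps)
  have "A + A = (\<Sum>j\<in>UNIV. \<Sum>l\<in>UNIV. e j * e l * D j l)"
    by (subst (2) A', unfold A_def, simp add: sum.distrib[symmetric] D_def)
      (intro sum.cong refl, simp add: algebra_simps)
  also have "\<dots> = (\<Sum>j\<in>UNIV. \<Sum>l\<in>UNIV. w * (s j l * e j) * D j l + w * (s l j * e l) * D j l)"
  proof (intro sum.cong refl)
    fix j l
    \<comment> \<open>\<open>D j j = 0\<close> settles the diagonal, where \<open>prod\<close> says
      nothing.\<close>
    show "e j * e l * D j l = w * (s j l * e j) * D j l + w * (s l j * e l) * D j l"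
      using prod[of j l] by (cases "j = l") (auto simp: D_def algebra_simps)
  qed
  also have "\<dots> = T + T"
    by (subst (2) T', unfold T_def, simp add: sum.distrib)
  finally have AT: "A = T" by simp
  have "(\<Sum>j\<in>UNIV. e j * (x j * y j)) = (\<Sum>j\<in>UNIV. e j * (x j * y j)) * (\<Sum>l\<in>UNIV. e l)"
    by (simp add: one)
  also have "\<dots> = (\<Sum>j\<in>UNIV. \<Sum>l\<in>UNIV. e j * e l * (x j * y j))"
    unfolding sum_product by (intro sum.cong refl) (simp add: mult_ac)
  finally have "(\<Sum>j\<in>UNIV. e j * (x j * y j)) - A = (\<Sum>j\<in>UNIV. \<Sum>l\<in>UNIV. e j * e l * (x j * y l))"
    by (simp add: A_def sum_subtractf[symmetric] algebra_simps)
  also have "\<dots> = (\<Sum>j\<in>UNIV. e j * x j) * (\<Sum>j\<in>UNIV. e j * y j)"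
    unfolding sum_product by (intro sum.cong refl) (simp add: mult_ac)
  finally have 1: "(\<Sum>j\<in>UNIV. e j * x j) * (\<Sum>j\<in>UNIV. e j * y j) = (\<Sum>j\<in>UNIV. e j * (x j * y j)) - T"
    using AT by simp
  have "T = (\<Sum>j\<in>UNIV. e j * (w * (\<Sum>l\<in>UNIV - {j}. s j l * (x j - x l) * (y j - y l))))"
    unfolding T_def
  proof (intro sum.cong refl)
    fix j
    have "(\<Sum>l\<in>UNIV. w * (s j l * e j) * D j l) = (\<Sum>l\<in>UNIV - {j}. w * (s j l * e j) * D j l)"
      by (intro sum.mono_neutral_right) (auto simp: D_def)
    then show "(\<Sum>l\<in>UNIV. w * (s j l * e j) * D j l) =
        e j * (w * (\<Sum>l\<in>UNIV - {j}. s j l * (x j - x l) * (y j - y l)))"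
      by (simp add: D_def sum_distrib_left mult_ac)
  qed
  then show ?thesis
    unfolding 1 by (simp add: right_diff_distrib sum_subtractf)
qed

section \<open>The Lagrange basis of a polynomial with simple roots\<close>

locale simple_roots =
  fixes p :: "complex poly" and rho :: "'d::finite \<Rightarrow> complex"
  assumes degree_p: "degree p = CARD('d)"
    and inj_rho: "inj rho"
    and roots_p: "{z. poly p z = 0} = range rho"
begin

abbreviation lagr :: "'d \<Rightarrow> complex \<Rightarrow> complex" where
  "lagr j z \<equiv> poly (lagrange_poly p (rho j)) z"

abbreviation dp :: "'d \<Rightarrow> complex" where
  "dp j \<equiv> poly (pderiv p) (rho j)"

text \<open>Up to the leading coefficient this is the divided difference of the constant 1 at the
  roots, so it is 0 unless \<open>CARD('d) = 1\<close>. Carrying it along lets the expansion of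
  \<open>z\<close> in the Lagrange basis cover degree one too.\<close>

definition dp_inverse_sum :: complex where
  "dp_inverse_sum = (\<Sum>j\<in>UNIV. 1 / dp j)"

lemma degree_pos: "degree p > 0"
  using degree_p by simp

lemma p_nonzero: "p \<noteq> 0"
  using degree_pos by auto

lemma root: "poly p (rho j) = 0"
  using roots_p by blast

lemma factor:
  obtains q where "p = [:- rho j, 1:] * q" "p div [:- rho j, 1:] = q" "degree q < CARD('d)"
    "dp j = poly q (rho j)"
proof -
  obtain q where q: "p = [:- rho j, 1:] * q"
    using root[of j] unfolding poly_eq_0_iff_dvd by (elim dvdE)
  have "p div [:- rho j, 1:] = q"
    unfolding q by (rule nonzero_mult_div_cancel_left) simp
  moreover have "q \<noteq> 0"
    using p_nonzero q by auto
  then have "degree p = Suc (degree q)"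
    unfolding q by (subst degree_mult_eq) auto
  moreover have "dp j = poly q (rho j)"
    unfolding q pderiv_mult by (simp add: pderiv_pCons)
  ultimately show ?thesis
    using that q degree_p by simp
qed

text \<open>If \<open>dp j\<close> were 0, the cofactor \<open>q\<close> of the root
  \<open>rho j\<close> would vanish at all roots of \<open>p\<close>, which are too many for its
  degree.\<close>

lemma dp_nonzero: "dp j \<noteq> 0"
proof -
  obtain q where q: "p = [:- rho j, 1:] * q" "degree q < CARD('d)" "dp j = poly q (rho j)"
    using factor[of j] by metis
  have "poly q (rho i) = 0" if "poly q (rho j) = 0" for i
    using root[of i] that inj_rho unfolding q(1) by (cases "i = j") (auto dest: injD)
  then show ?thesis
    using poly_zero_if_enough_roots[OF inj_rho, of q] q p_nonzero by auto
qed

lemma degree_lagrange: "degree (lagrange_poly p (rho j)) < CARD('d)"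
  using factor[of j] degree_smult_le[of "1 / dp j"] unfolding lagrange_poly_def
  by (metis le_less_trans)

lemma lagr_mult: "(z - rho j) * lagr j z = poly p z / dp j"
proof -
  obtain q where q: "p = [:- rho j, 1:] * q" "p div [:- rho j, 1:] = q"
    using factor[of j] by metis
  have "poly p z = (z - rho j) * poly q z"
    by (subst q(1)) (simp add: algebra_simps)
  then show ?thesis
    unfolding lagrange_poly_def q(2) by simp
qed

lemma lagr_rho: "lagr j (rho i) = (if i = j then 1 else 0)"
proof (cases "i = j")
  case True
  then show ?thesis
    using poly_lagrange_poly_self[OF root dp_nonzero] by simp
next
  case False
  then show ?thesis
    using lagr_mult[of "rho i" j] root[of i] inj_rho by (auto dest: injD)
qed

lemma sum_lagr: "(\<Sum>j\<in>UNIV. lagr j z) = 1"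
proof -
  let ?q = "(\<Sum>j\<in>UNIV. lagrange_poly p (rho j)) - 1"
  have "degree (\<Sum>j\<in>UNIV. lagrange_poly p (rho j)) < CARD('d)"
    by (intro degree_sum_less) (auto simp: degree_lagrange)
  then have "degree ?q < CARD('d)"
    by (intro degree_diff_less) auto
  moreover have "poly ?q (rho i) = 0" for i
    by (simp add: poly_sum lagr_rho)
  ultimately have "?q = 0"
    using poly_zero_if_enough_roots[OF inj_rho] by blast
  then have "poly ?q z = 0" by simp
  then show ?thesis by (simp add: poly_sum)
qed

text \<open>Write \<open>rho j - rho l\<close> as \<open>(z - rho l) - (z - rho j)\<close>; by
  \<open>lagr_mult\<close> each linear factor turns its own Lagrange polynomial into a multiple of
  \<open>p\<close>.\<close>

lemma lagr_prod:
  assumes "j \<noteq> l"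
  shows "lagr j z * lagr l z =
    poly p z * (sigma_coeff p rho j l * lagr j z + sigma_coeff p rho l j * lagr l z)"
proof -
  have ne: "rho j - rho l \<noteq> 0" "rho l - rho j \<noteq> 0"
    using assms inj_rho by (auto dest: injD)
  have "(rho j - rho l) * (lagr j z * lagr l z) =
      lagr j z * ((z - rho l) * lagr l z) - ((z - rho j) * lagr j z) * lagr l z"
    by (simp add: algebra_simps)
  also have "\<dots> = poly p z * (lagr j z / dp l - lagr l z / dp j)"
    unfolding lagr_mult by (simp add: algebra_simps)
  finally have "lagr j z * lagr l z = poly p z * (lagr j z / dp l - lagr l z / dp j) / (rho j - rho l)"
    using ne by (simp add: field_simps)
  moreover have "sigma_coeff p rho l j = - (1 / (dp j * (rho j - rho l)))"
    using ne dp_nonzero[of j] by (simp add: sigma_coeff_def field_simps)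
  moreover have "sigma_coeff p rho j l = 1 / (dp l * (rho j - rho l))"
    by (simp add: sigma_coeff_def)
  ultimately show ?thesis
    by (simp add: diff_divide_distrib algebra_simps)
qed

text \<open>It recovers a point from the Lagrange values and the value of \<open>p\<close> there.
  The proof multiplies \<open>z\<close> by the sum of all \<open>lagr j z\<close>, which is
  1.\<close>

lemma identity_expansion:
  "z = (\<Sum>j\<in>UNIV. rho j * lagr j z) + dp_inverse_sum * poly p z"
proof -
  have "z - (\<Sum>j\<in>UNIV. rho j * lagr j z) = z * (\<Sum>j\<in>UNIV. lagr j z) - (\<Sum>j\<in>UNIV. rho j * lagr j z)"
    by (simp add: sum_lagr)
  also have "\<dots> = (\<Sum>j\<in>UNIV. (z - rho j) * lagr j z)"
    by (simp add: sum_distrib_left sum_subtractf algebra_simps)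
  also have "\<dots> = dp_inverse_sum * poly p z"
    by (simp add: lagr_mult dp_inverse_sum_def sum_distrib_right)
  finally show ?thesis by (simp add: algebra_simps)
qed

text \<open>The point \<open>z\<close> is read off from \<open>identity_expansion\<close> with
  \<open>a\<close> in place of the Lagrange values. The relations then give
  \<open>(z - rho j) * a j = w / dp j\<close>, the counterpart of \<open>lagr_mult\<close>, and
  comparing the two identifies first \<open>w\<close> and then \<open>a\<close>.\<close>

lemma lagr_of_relations:
  fixes a :: "'d \<Rightarrow> complex"
  assumes one: "(\<Sum>j\<in>UNIV. a j) = 1"
    and prod: "\<And>j l. j \<noteq> l \<Longrightarrow>
      a j * a l = w * (sigma_coeff p rho j l * a j + sigma_coeff p rho l j * a l)"
  defines "z \<equiv> (\<Sum>j\<in>UNIV. rho j * a j) + dp_inverse_sum * w"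
  shows "poly p z = w" "a j = lagr j z"
proof -
  have am: "(z - rho j) * a j = w / dp j" for j
  proof -
    \<comment> \<open>Multiplying \<open>rho j * a j\<close> by the sum of the \<open>a l\<close>
      leaves only products \<open>a l * a j\<close>, which the relations linearise; the two terms
      with \<open>dp_inverse_sum\<close> then cancel.\<close>
    have "(z - rho j) * a j = (\<Sum>l\<in>UNIV. (rho l - rho j) * (a l * a j)) + dp_inverse_sum * w * a j"
    proof -
      have "(\<Sum>l\<in>UNIV. (rho l - rho j) * (a l * a j)) =
          (\<Sum>l\<in>UNIV. rho l * a l) * a j - rho j * a j * (\<Sum>l\<in>UNIV. a l)"
        by (simp add: sum_distrib_left sum_distrib_right sum_subtractf algebra_simps)
      then show ?thesis
        by (simp add: one z_def algebra_simps)
    qed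
    also have "(\<Sum>l\<in>UNIV. (rho l - rho j) * (a l * a j)) = (\<Sum>l\<in>UNIV. w * (a l / dp j - a j / dp l))"
    proof (intro sum.cong refl)
      fix l
      show "(rho l - rho j) * (a l * a j) = w * (a l / dp j - a j / dp l)"
      proof (cases "l = j")
        case False
        have ne: "rho j - rho l \<noteq> 0" "rho l - rho j \<noteq> 0"
          using False inj_rho by (auto dest: injD)
        have "(rho l - rho j) * (a l * a j) = w * ((rho l - rho j) * sigma_coeff p rho l j * a l
            + (rho l - rho j) * sigma_coeff p rho j l * a j)"
          unfolding prod[OF False] by (simp add: algebra_simps)
        also have "(rho l - rho j) * sigma_coeff p rho l j = 1 / dp j"
          using ne by (simp add: sigma_coeff_def)
        also have "(rho l - rho j) * sigma_coeff p rho j l = - 1 / dp l"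
          using ne dp_nonzero[of l] by (simp add: sigma_coeff_def field_simps)
        finally show ?thesis by simp
      qed simp
    qed
    also have "(\<Sum>l\<in>UNIV. w * (a l / dp j - a j / dp l)) =
        w / dp j * (\<Sum>l\<in>UNIV. a l) - w * a j * dp_inverse_sum"
      by (simp add: dp_inverse_sum_def sum_distrib_left sum_divide_distrib sum_subtractf algebra_simps)
    finally show ?thesis
      by (simp add: one)
  qed
  \<comment> \<open>Cross-multiplying \<open>am\<close> with \<open>lagr_mult\<close> avoids a
    division by \<open>z - rho j\<close>, which may be 0.\<close>
  have pa: "poly p z * a j = w * lagr j z" for j
  proof -
    have "poly p z * a j = dp j * ((z - rho j) * lagr j z) * a j"
      using dp_nonzero[of j] unfolding lagr_mult by simp
    also have "\<dots> = dp j * ((z - rho j) * a j) * lagr j z"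
      by simp
    also have "\<dots> = w * lagr j z"
      using dp_nonzero[of j] unfolding am by simp
    finally show ?thesis .
  qed
  have "poly p z * (\<Sum>j\<in>UNIV. a j) = w * (\<Sum>j\<in>UNIV. lagr j z)"
    unfolding sum_distrib_left pa ..
  then show pz: "poly p z = w"
    by (simp add: one sum_lagr)
  show "a j = lagr j z"
  proof (cases "w = 0")
    case False
    then show ?thesis
      using pa[of j] pz by simp
  next
    \<comment> \<open>Here \<open>pa\<close> reads 0 = 0. But \<open>z\<close> is some root
      \<open>rho i\<close>, so \<open>am\<close> kills every \<open>a l\<close> with
      \<open>l \<noteq> i\<close>, and the sum condition forces \<open>a i = 1\<close>.\<close>
    case True
    then obtain i where i: "z = rho i"
      using pz roots_p by auto
    have z0: "a l = 0" if "l \<noteq> i" for l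
      using am[of l] that inj_rho unfolding True i by (auto dest: injD)
    have "(\<Sum>l\<in>UNIV. a l) = (\<Sum>l\<in>UNIV. if l = i then a i else 0)"
      by (intro sum.cong refl) (simp add: z0)
    then have "a i = 1"
      using one by simp
    then show ?thesis
      using z0[of j] unfolding i lagr_rho by auto
  qed
qed

text \<open>The combination of Lagrange polynomials has degree below \<open>CARD('d)\<close> and
  that many zeros, so it is the zero polynomial; its value at \<open>rho j\<close> is
  \<open>c j\<close>.\<close>

lemma lagr_independent:
  fixes r :: "'d \<Rightarrow> complex"
  assumes "inj r" "\<And>i. (\<Sum>j\<in>UNIV. lagr j (r i) * c j) = 0"
  shows "c j = 0"
proof -
  let ?q = "\<Sum>j\<in>UNIV. Polynomial.smult (c j) (lagrange_poly p (rho j))"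
  have "degree ?q < CARD('d)"
    by (intro degree_sum_less) (auto intro: le_less_trans[OF degree_smult_le] simp: degree_lagrange)
  moreover have "poly ?q (r i) = 0" for i
    using assms(2)[of i] by (simp add: poly_sum mult.commute)
  ultimately have "?q = 0"
    using poly_zero_if_enough_roots[OF assms(1)] by blast
  then have "poly ?q (rho j) = 0" by simp
  then show ?thesis
    by (simp add: poly_sum lagr_rho if_distrib[of "(*) _"] cong: if_cong)
qed

text \<open>Away from the critical values of \<open>p\<close>, the polynomial \<open>p - w\<close>
  is squarefree and so has as many distinct zeros as its degree.\<close>

lemma regular_value_roots:
  assumes "w \<notin> poly p ` {z. poly (pderiv p) z = 0}"
  obtains r :: "'d \<Rightarrow> complex" where "inj r" "\<And>i. poly p (r i) = w"
proof -
  let ?q = "p - [:w:]"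
  have deg: "degree ?q = CARD('d)"
    using degree_pos degree_p degree_add_eq_left[of "- [:w:]" p] by (simp del: minus_pCons)
  have "rsquarefree ?q"
    using assms by (auto simp: rsquarefree_roots pderiv_diff)
  then have "Polynomial.smult (lead_coeff ?q) (\<Prod>z|poly ?q z = 0. [:- z, 1:]) = ?q"
    by (rule complex_poly_decompose_rsquarefree)
  \<comment> \<open>Comparing degrees in the factorisation into distinct linear factors counts the
    zeros.\<close>
  then have "degree (Polynomial.smult (lead_coeff ?q) (\<Prod>z|poly ?q z = 0. [:- z, 1:])) = CARD('d)"
    using deg by simp
  moreover have "lead_coeff ?q \<noteq> 0"
    using deg by (metis degree_0 leading_coeff_0_iff zero_less_card_finite less_irrefl)
  ultimately have "degree (\<Prod>z|poly ?q z = 0. [:- z, 1:]) = CARD('d)"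
    by simp
  then have "card {z. poly ?q z = 0} = CARD('d)"
    by (subst (asm) degree_prod_eq_sum_degree) auto
  then obtain r :: "'d \<Rightarrow> complex" where "bij_betw r UNIV {z. poly ?q z = 0}"
    using finite_same_card_bij[of "UNIV :: 'd set" "{z. poly ?q z = 0}"]
    by (metis card.infinite finite_UNIV zero_less_card_finite less_irrefl)
  then show ?thesis
    by (intro that[of r]) (auto simp: bij_betw_def)
qed

text \<open>There are only finitely many critical values, and the plane has no isolated
  points.\<close>

lemma regular_values_dense:
  obtains u :: "nat \<Rightarrow> complex" where "\<And>n. u n \<notin> poly p ` {z. poly (pderiv p) z = 0}"
    "u \<longlonglongrightarrow> w"
proof -
  let ?F = "poly p ` {z. poly (pderiv p) z = 0}"
  have "finite ?F"
    using degree_pos by (intro finite_imageI poly_roots_finite) (auto simp: pderiv_eq_0_iff)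
  then have "w islimpt (- ?F)"
    using islimpt_Un_finite[of ?F w "- ?F"] islimpt_UNIV[of w] by (simp add: Compl_partition)
  then show ?thesis
    unfolding islimpt_sequential using that by blast
qed

end

section \<open>Fiber algebras\<close>

text \<open>The polyproduct at \<open>w\<close> sees only the values at \<open>w\<close>, so
  constant functions express the product of two matrices in the fiber over \<open>w\<close>.\<close>

definition fiber_product ::
  "complex poly \<Rightarrow> complex poly \<Rightarrow> ('d1::finite \<Rightarrow> complex) \<Rightarrow> ('d2::finite \<Rightarrow> complex) \<Rightarrow>
   complex \<times> complex \<Rightarrow> complex^'d2^'d1 \<Rightarrow> complex^'d2^'d1 \<Rightarrow> complex^'d2^'d1" where
  "fiber_product p1 p2 lam mu w F G = polyproduct p1 p2 lam mu (\<lambda>_. F) (\<lambda>_. G) w"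

definition fiber_eval ::
  "complex poly \<Rightarrow> complex poly \<Rightarrow> ('d1::finite \<Rightarrow> complex) \<Rightarrow> ('d2::finite \<Rightarrow> complex) \<Rightarrow>
   complex \<times> complex \<Rightarrow> complex^'d2^'d1 \<Rightarrow> complex" where
  "fiber_eval p1 p2 lam mu z F = multicentric_sum p1 p2 lam mu (\<lambda>_. F) z"

lemma polyproduct_eq_fiber_product:
  "polyproduct p1 p2 lam mu f g w = fiber_product p1 p2 lam mu w (f w) (g w)"
  by (simp add: fiber_product_def polyproduct_def split_beta)

lemma multicentric_sum_eq_fiber_eval:
  "multicentric_sum p1 p2 lam mu f z =
    fiber_eval p1 p2 lam mu z (f (poly p1 (fst z), poly p2 (snd z)))"
  by (simp add: fiber_eval_def multicentric_sum_def split_beta)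

lemma fiber_eval_altdef:
  "fiber_eval p1 p2 lam mu z F = (\<Sum>j\<in>UNIV. poly (lagrange_poly p1 (lam j)) (fst z) *
     (\<Sum>k\<in>UNIV. poly (lagrange_poly p2 (mu k)) (snd z) * F $ j $ k))"
  by (simp add: fiber_eval_def multicentric_sum_def split_beta sum_distrib_left mult.assoc)

lemma fiber_product_nth:
  "fiber_product p1 p2 lam mu w F G $ j $ k =
     F$j$k * G$j$k
     - fst w * (\<Sum>l\<in>UNIV - {j}. sigma_coeff p1 lam j l * (F$j$k - F$l$k) * (G$j$k - G$l$k))
     - snd w * (\<Sum>m\<in>UNIV - {k}. sigma_coeff p2 mu k m * (F$j$k - F$j$m) * (G$j$k - G$j$m))
     + fst w * snd w * (\<Sum>l\<in>UNIV - {j}. \<Sum>m\<in>UNIV - {k}.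
         sigma_coeff p1 lam j l * sigma_coeff p2 mu k m *
         ((F$j$k - F$j$m) - (F$l$k - F$l$m)) * ((G$j$k - G$j$m) - (G$l$k - G$l$m)))"
  by (simp add: fiber_product_def polyproduct_def split_beta Let_def)

lemma fiber_product_commute:
  "fiber_product p1 p2 lam mu w F G = fiber_product p1 p2 lam mu w G F"
  by (simp add: vec_eq_iff fiber_product_nth mult_ac)

lemma fiber_product_add_right:
  "fiber_product p1 p2 lam mu w F (G + H) = fiber_product p1 p2 lam mu w F G + fiber_product p1 p2 lam mu w F H"
  by (simp add: vec_eq_iff fiber_product_nth add_diff_add distrib_left sum.distrib)

lemma fiber_product_scale_right:
  "fiber_product p1 p2 lam mu w F (\<chi> j k. c * G$j$k) = (\<chi> j k. c * fiber_product p1 p2 lam mu w F G $ j $ k)"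
  by (simp add: vec_eq_iff fiber_product_nth right_diff_distrib[symmetric] distrib_left
      sum_distrib_left mult_ac) (simp add: right_diff_distrib sum_distrib_left mult_ac)

lemma fiber_product_scalar_left:
  "fiber_product p1 p2 lam mu w (\<chi> j k. c) G = (\<chi> j k. c * G$j$k)"
  by (simp add: vec_eq_iff fiber_product_nth)

lemma continuous_on_fiber_product [continuous_intros]:
  assumes "continuous_on S w" "continuous_on S F" "continuous_on S G"
  shows "continuous_on S (\<lambda>x. fiber_product p1 p2 lam mu (w x) (F x) (G x))"
proof -
  have "continuous_on S (\<lambda>x. \<chi> j k. fiber_product p1 p2 lam mu (w x) (F x) (G x) $ j $ k)"
    unfolding fiber_product_nth by (intro continuous_intros assms)
  then show ?thesis by simp
qed

section \<open>Multiplication in a fiber as a matrix\<close>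

lemma continuous_on_det [continuous_intros]:
  fixes A :: "'a::topological_space \<Rightarrow> 'b::real_normed_field^'n^'n"
  assumes "continuous_on S A"
  shows "continuous_on S (\<lambda>x. det (A x))"
  unfolding det_def by (intro continuous_intros assms)

text \<open>Determinants and Cramer's rule use vectors over one index type, so matrix entries are
  indexed by pairs.\<close>

definition flatten :: "complex^'d2^'d1 \<Rightarrow> complex^('d1::finite \<times> 'd2::finite)" where
  "flatten F = (\<chi> a. F $ fst a $ snd a)"

definition unflatten :: "complex^('d1::finite \<times> 'd2::finite) \<Rightarrow> complex^'d2^'d1" where
  "unflatten x = (\<chi> j k. x $ (j, k))"

lemma unflatten_flatten [simp]: "unflatten (flatten F) = F"
  by (simp add: flatten_def unflatten_def vec_eq_iff)

lemma flatten_unflatten [simp]: "flatten (unflatten x) = x"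
  by (simp add: flatten_def unflatten_def vec_eq_iff)

text \<open>The determinant of this matrix is the norm of \<open>G\<close> in the fiber algebra over
  \<open>w\<close>.\<close>

definition mult_matrix ::
  "complex poly \<Rightarrow> complex poly \<Rightarrow> ('d1::finite \<Rightarrow> complex) \<Rightarrow> ('d2::finite \<Rightarrow> complex) \<Rightarrow>
   complex \<times> complex \<Rightarrow> complex^'d2^'d1 \<Rightarrow> complex^('d1 \<times> 'd2)^('d1 \<times> 'd2)" where
  "mult_matrix p1 p2 lam mu w G = matrix (\<lambda>x. flatten (fiber_product p1 p2 lam mu w G (unflatten x)))"

lemma mult_matrix_vector:
  "mult_matrix p1 p2 lam mu w G *v x = flatten (fiber_product p1 p2 lam mu w G (unflatten x))"
  unfolding mult_matrix_def
proof (rule matrix_works, unfold_locales)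
  have scale: "unflatten (c *s x) = (\<chi> j k. c * unflatten x $ j $ k)" for c and x :: "complex^('a \<times> 'b)"
    by (simp add: vec_eq_iff unflatten_def)
  show "flatten (fiber_product p1 p2 lam mu w G (unflatten (c *s x))) =
      c *s flatten (fiber_product p1 p2 lam mu w G (unflatten x))" for c x
    unfolding scale fiber_product_scale_right by (simp add: flatten_def vec_eq_iff)
  have add: "unflatten (x + y) = unflatten x + unflatten y" for x y :: "complex^('a \<times> 'b)"
    by (simp add: vec_eq_iff unflatten_def)
  show "flatten (fiber_product p1 p2 lam mu w G (unflatten (x + y))) =
      flatten (fiber_product p1 p2 lam mu w G (unflatten x)) +
      flatten (fiber_product p1 p2 lam mu w G (unflatten y))" for x y
    unfolding add fiber_product_add_right by (simp add: flatten_def vec_eq_iff)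
qed

lemma continuous_on_mult_matrix [continuous_intros]:
  assumes "continuous_on S w" "continuous_on S G"
  shows "continuous_on S (\<lambda>x. mult_matrix p1 p2 lam mu (w x) (G x))"
  unfolding mult_matrix_def matrix_def flatten_def
  by (simp, intro continuous_intros assms)

lemma sum_UNIV_prod:
  "(\<Sum>a\<in>(UNIV::('a::finite \<times> 'b::finite) set). f a) = (\<Sum>j\<in>UNIV. \<Sum>k\<in>UNIV. f (j, k))"
  unfolding UNIV_Times_UNIV[symmetric] sum.cartesian_product by simp

section \<open>Evaluation at the points of a fiber and the determinant\<close>

locale simple_roots_pair = A: simple_roots p1 lam + B: simple_roots p2 mu
  for p1 p2 :: "complex poly"
    and lam :: "'d1::finite \<Rightarrow> complex" and mu :: "'d2::finite \<Rightarrow> complex"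
begin

abbreviation fprod where "fprod \<equiv> fiber_product p1 p2 lam mu"
abbreviation feval where "feval \<equiv> fiber_eval p1 p2 lam mu"
abbreviation mmat where "mmat \<equiv> mult_matrix p1 p2 lam mu"

text \<open>\<open>bilinear_sum_expand\<close> is applied twice: in the first variable to the inner
  sums \<open>x\<close> and \<open>y\<close>, then in the second variable to every product of inner
  sums that arises. The nested corrections are the four terms of the polyproduct.\<close>

lemma fiber_eval_product:
  "feval z (fprod (poly p1 (fst z), poly p2 (snd z)) F G) = feval z F * feval z G"
proof -
  let ?w1 = "poly p1 (fst z)" and ?w2 = "poly p2 (snd z)"
  let ?a = "\<lambda>j. A.lagr j (fst z)" and ?b = "\<lambda>k. B.lagr k (snd z)"
  let ?s = "sigma_coeff p1 lam" and ?t = "sigma_coeff p2 mu"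
  \<comment> \<open>\<open>P\<close> is the one-variable product in the second coordinate.\<close>
  define P where "P x y k = x k * y k - ?w2 * (\<Sum>m\<in>UNIV - {k}. ?t k m * (x k - x m) * (y k - y m))"
    for x y :: "'d2 \<Rightarrow> complex" and k
  define x where "x j = (\<Sum>k\<in>UNIV. ?b k * F$j$k)" for j
  define y where "y j = (\<Sum>k\<in>UNIV. ?b k * G$j$k)" for j
  have mult2: "(\<Sum>k\<in>UNIV. ?b k * u k) * (\<Sum>k\<in>UNIV. ?b k * v k) = (\<Sum>k\<in>UNIV. ?b k * P u v k)" for u v
    unfolding P_def by (rule bilinear_sum_expand) (auto simp: B.sum_lagr B.lagr_prod)
  have "feval z F * feval z G = (\<Sum>j\<in>UNIV. ?a j * x j) * (\<Sum>j\<in>UNIV. ?a j * y j)"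
    by (simp add: fiber_eval_altdef x_def y_def)
  also have "\<dots> = (\<Sum>j\<in>UNIV. ?a j * (x j * y j -
      ?w1 * (\<Sum>l\<in>UNIV - {j}. ?s j l * (x j - x l) * (y j - y l))))"
    by (rule bilinear_sum_expand) (auto simp: A.sum_lagr A.lagr_prod)
  also have "\<dots> = feval z (fprod (?w1, ?w2) F G)"
    unfolding fiber_eval_altdef
  proof (intro sum.cong refl arg_cong2[where f = "(*)"])
    fix j
    have d: "x j - x l = (\<Sum>k\<in>UNIV. ?b k * (F$j$k - F$l$k))"
      "y j - y l = (\<Sum>k\<in>UNIV. ?b k * (G$j$k - G$l$k))" for l
      by (simp_all add: x_def y_def sum_subtractf right_diff_distrib)
    have xy: "x j * y j = (\<Sum>k\<in>UNIV. ?b k * P (\<lambda>k. F$j$k) (\<lambda>k. G$j$k) k)"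
      unfolding x_def y_def by (rule mult2)
    have dd: "(x j - x l) * (y j - y l) =
        (\<Sum>k\<in>UNIV. ?b k * P (\<lambda>k. F$j$k - F$l$k) (\<lambda>k. G$j$k - G$l$k) k)" for l
      unfolding d by (rule mult2)
    have "x j * y j - ?w1 * (\<Sum>l\<in>UNIV - {j}. ?s j l * (x j - x l) * (y j - y l)) =
        (\<Sum>k\<in>UNIV. ?b k * P (\<lambda>k. F$j$k) (\<lambda>k. G$j$k) k) - ?w1 * (\<Sum>l\<in>UNIV - {j}. ?s j l *
          (\<Sum>k\<in>UNIV. ?b k * P (\<lambda>k. F$j$k - F$l$k) (\<lambda>k. G$j$k - G$l$k) k))"
      by (simp only: mult.assoc xy dd)
    also have "\<dots> = (\<Sum>k\<in>UNIV. ?b k * (P (\<lambda>k. F$j$k) (\<lambda>k. G$j$k) k - ?w1 * (\<Sum>l\<in>UNIV - {j}.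
        ?s j l * P (\<lambda>k. F$j$k - F$l$k) (\<lambda>k. G$j$k - G$l$k) k)))"
      unfolding sum_distrib_left right_diff_distrib sum_subtractf
      by (subst sum.swap) (simp add: mult_ac)
    also have "\<dots> = (\<Sum>k\<in>UNIV. ?b k * fprod (?w1, ?w2) F G $ j $ k)"
    proof (intro sum.cong refl arg_cong2[where f = "(*)"])
      fix k
      \<comment> \<open>The nesting takes row differences first and column differences second; the
        polyproduct takes them in the other order.\<close>
      have sw: "(F$j$k - F$l$k) - (F$j$m - F$l$m) = (F$j$k - F$j$m) - (F$l$k - F$l$m)"
        "(G$j$k - G$l$k) - (G$j$m - G$l$m) = (G$j$k - G$j$m) - (G$l$k - G$l$m)" for l m
        by simp_all
      have sP: "?s j l * P (\<lambda>k. F$j$k - F$l$k) (\<lambda>k. G$j$k - G$l$k) k =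
          ?s j l * (F$j$k - F$l$k) * (G$j$k - G$l$k) - ?w2 * (\<Sum>m\<in>UNIV - {k}. ?s j l * ?t k m *
            ((F$j$k - F$j$m) - (F$l$k - F$l$m)) * ((G$j$k - G$j$m) - (G$l$k - G$l$m)))" for l
        unfolding P_def sw right_diff_distrib[of "?s j l" "(F$j$k - F$l$k) * (G$j$k - G$l$k)"]
        by (simp only: sum_distrib_left mult_ac)
      show "P (\<lambda>k. F$j$k) (\<lambda>k. G$j$k) k - ?w1 * (\<Sum>l\<in>UNIV - {j}.
          ?s j l * P (\<lambda>k. F$j$k - F$l$k) (\<lambda>k. G$j$k - G$l$k) k) = fprod (?w1, ?w2) F G $ j $ k"
        unfolding sP sum_subtractf right_diff_distrib[of ?w1]
        unfolding P_def fiber_product_nth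
        by (simp add: sum_distrib_left mult_ac)
    qed
    finally show "x j * y j - ?w1 * (\<Sum>l\<in>UNIV - {j}. ?s j l * (x j - x l) * (y j - y l)) =
      (\<Sum>k\<in>UNIV. ?b k * fprod (?w1, ?w2) F G $ j $ k)" .
  qed
  finally show ?thesis ..
qed

text \<open>Evaluation at the points above \<open>w\<close> is multiplicative, so the evaluation
  matrix \<open>E\<close> conjugates multiplication by \<open>G\<close> into the diagonal matrix
  \<open>D\<close> of the values of \<open>G\<close>.\<close>

lemma det_mult_matrix_regular:
  fixes r :: "'d1 \<Rightarrow> complex" and s :: "'d2 \<Rightarrow> complex"
  assumes r: "inj r" "\<And>i. poly p1 (r i) = fst w" and s: "inj s" "\<And>i. poly p2 (s i) = snd w"
  shows "det (mmat w G) = (\<Prod>a\<in>UNIV. feval (r (fst a), s (snd a)) G)"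
proof -
  define E :: "complex^('d1 \<times> 'd2)^('d1 \<times> 'd2)" where
    "E = (\<chi> a b. A.lagr (fst b) (r (fst a)) * B.lagr (snd b) (s (snd a)))"
  define D :: "complex^('d1 \<times> 'd2)^('d1 \<times> 'd2)" where
    "D = (\<chi> a b. if a = b then feval (r (fst a), s (snd a)) G else 0)"
  have Ev: "(E *v x) $ a = feval (r (fst a), s (snd a)) (unflatten x)" for x a
    by (simp add: E_def matrix_vector_mult_def fiber_eval_altdef sum_UNIV_prod unflatten_def
        sum_distrib_left mult.assoc)
  have Dv: "(D *v x) $ a = feval (r (fst a), s (snd a)) G * x $ a" for x a
    by (simp add: D_def matrix_vector_mult_def if_distrib[of "\<lambda>c. c * _"] cong: if_cong)
  have "E ** mmat w G = D ** E"
  proof (unfold matrix_eq matrix_vector_mul_assoc[symmetric], intro allI, unfold vec_eq_iff, intro allI)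
    fix x a
    show "(E *v (mmat w G *v x)) $ a = (D *v (E *v x)) $ a"
      unfolding Ev Dv mult_matrix_vector unflatten_flatten
      using fiber_eval_product[of "(r (fst a), s (snd a))" G "unflatten x"] by (simp add: r(2) s(2))
  qed
  then have "det E * det (mmat w G) = det D * det E"
    by (simp flip: det_mul)
  moreover have "det E \<noteq> 0"
  proof -
    \<comment> \<open>Independence is used one variable at a time: first with the inner sums over
      \<open>k\<close> as coefficients, then with the entries themselves.\<close>
    have "x = 0" if "E *v x = 0" for x
    proof -
      have 0: "feval (r i, s k) (unflatten x) = 0" for i k
        using Ev[of x "(i, k)"] that by simp
      have "(\<Sum>k\<in>UNIV. B.lagr k (s i) * unflatten x $ j $ k) = 0" for i j
      proof (rule A.lagr_independent[OF r(1),
            where c = "\<lambda>j. \<Sum>k\<in>UNIV. B.lagr k (s i) * unflatten x $ j $ k"])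
        show "(\<Sum>j\<in>UNIV. A.lagr j (r i') * (\<Sum>k\<in>UNIV. B.lagr k (s i) * unflatten x $ j $ k)) = 0" for i'
          using 0[of i' i] unfolding fiber_eval_altdef by simp
      qed
      then have u0: "unflatten x $ j $ k = 0" for j k
        by (rule B.lagr_independent[OF s(1), where c = "\<lambda>k. unflatten x $ j $ k"])
      then have "x $ (j, k) = 0" for j k
        using u0[of j k] by (simp add: unflatten_def)
      then show "x = 0"
        by (simp add: vec_eq_iff)
    qed
    then have "\<exists>C. C ** E = mat 1"
      unfolding matrix_left_invertible_ker by (intro allI impI)
    then have "invertible E"
      unfolding invertible_left_inverse .
    then show ?thesis
      unfolding invertible_det_nz .
  qed
  ultimately have "det (mmat w G) = det D"
    by (simp add: mult.commute)
  also have "\<dots> = (\<Prod>a\<in>UNIV. feval (r (fst a), s (snd a)) G)"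
    by (subst det_diagonal) (auto simp: D_def)
  finally show ?thesis .
qed

text \<open>The smallest factor of the product, raised to the number of factors, is at most the
  product. This estimate, unlike a list of distinct points above \<open>w\<close>, survives the
  passage to a critical value.\<close>

lemma fiber_eval_le_det_regular:
  assumes "fst w \<notin> poly p1 ` {z. poly (pderiv p1) z = 0}"
    and "snd w \<notin> poly p2 ` {z. poly (pderiv p2) z = 0}"
  obtains z where "poly p1 (fst z) = fst w" "poly p2 (snd z) = snd w"
    "cmod (feval z G) ^ CARD('d1 \<times> 'd2) \<le> cmod (det (mmat w G))"
proof -
  obtain r :: "'d1 \<Rightarrow> complex" where r: "inj r" "\<And>i. poly p1 (r i) = fst w"
    using A.regular_value_roots[OF assms(1)] by blast
  obtain s :: "'d2 \<Rightarrow> complex" where s: "inj s" "\<And>i. poly p2 (s i) = snd w"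
    using B.regular_value_roots[OF assms(2)] by blast
  let ?f = "\<lambda>a. cmod (feval (r (fst a), s (snd a)) G)"
  obtain a where "is_arg_min ?f (\<lambda>x. x \<in> UNIV) a"
    using ex_is_arg_min_if_finite[of "UNIV :: ('d1 \<times> 'd2) set" ?f] by auto
  then have a: "?f a \<le> ?f b" for b
    unfolding is_arg_min_linorder by blast
  have "?f a ^ CARD('d1 \<times> 'd2) = (\<Prod>b\<in>(UNIV::('d1 \<times> 'd2) set). ?f a)"
    by simp
  also have "\<dots> \<le> (\<Prod>b\<in>UNIV. ?f b)"
    by (intro prod_mono) (auto simp: a)
  also have "\<dots> = cmod (det (mmat w G))"
    unfolding det_mult_matrix_regular[OF r s] prod_norm ..
  finally show ?thesis
    using r s by (intro that[of "(r (fst a), s (snd a))"]) auto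
qed

lemma continuous_on_fiber_eval [continuous_intros]:
  assumes "continuous_on S z" "continuous_on S F"
  shows "continuous_on S (\<lambda>x. feval (z x) (F x))"
  unfolding fiber_eval_altdef by (intro continuous_intros assms)

lemma det_mult_matrix_zero:
  assumes "det (mmat w G) = 0"
  obtains z where "poly p1 (fst z) = fst w" "poly p2 (snd z) = snd w" "feval z G = 0"
proof -
  let ?N = "CARD('d1 \<times> 'd2)"
  obtain u where u: "\<And>n. u n \<notin> poly p1 ` {z. poly (pderiv p1) z = 0}" "u \<longlonglongrightarrow> fst w"
    using A.regular_values_dense by blast
  obtain v where v: "\<And>n. v n \<notin> poly p2 ` {z. poly (pderiv p2) z = 0}" "v \<longlonglongrightarrow> snd w"
    using B.regular_values_dense by blast
  have "\<exists>z. poly p1 (fst z) = u n \<and> poly p2 (snd z) = v n \<and>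
      cmod (feval z G) ^ ?N \<le> cmod (det (mmat (u n, v n) G))" for n
    using fiber_eval_le_det_regular[of "(u n, v n)" G] u(1) v(1) by (metis fst_conv snd_conv)
  then obtain z where z: "\<And>n. poly p1 (fst (z n)) = u n" "\<And>n. poly p2 (snd (z n)) = v n"
    "\<And>n. cmod (feval (z n) G) ^ ?N \<le> cmod (det (mmat (u n, v n) G))"
    by metis
  \<comment> \<open>The chosen points lie above bounded sets of values, so a subsequence converges
    to some \<open>l\<close>; continuity puts \<open>l\<close> above \<open>w\<close> and carries
    the estimate over.\<close>
  have "bounded (range u)" "bounded (range v)"
    using u(2) v(2) by (auto intro: convergent_imp_bounded)
  then have "bounded ((poly p1 -` range u) \<times> (poly p2 -` range v))"
    by (intro bounded_Times bounded_poly_vimage A.degree_pos B.degree_pos)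
  moreover have "range z \<subseteq> (poly p1 -` range u) \<times> (poly p2 -` range v)"
    by (rule image_subsetI) (simp add: mem_Times_iff z)
  ultimately have "bounded (range z)"
    by (rule bounded_subset)
  then obtain l h where h: "strict_mono (h :: nat \<Rightarrow> nat)" and l: "(z \<circ> h) \<longlonglongrightarrow> l"
    using bounded_imp_convergent_subsequence by blast
  have lim: "(\<lambda>n. poly p1 (fst (z (h n)))) \<longlonglongrightarrow> poly p1 (fst l)"
    "(\<lambda>n. poly p2 (snd (z (h n)))) \<longlonglongrightarrow> poly p2 (snd l)"
    using l by (auto intro!: tendsto_intros simp: o_def)
  have uh: "(\<lambda>n. u (h n)) \<longlonglongrightarrow> fst w" and vh: "(\<lambda>n. v (h n)) \<longlonglongrightarrow> snd w"
    using LIMSEQ_subseq_LIMSEQ[OF u(2) h] LIMSEQ_subseq_LIMSEQ[OF v(2) h] by (simp_all add: o_def)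
  have p: "poly p1 (fst l) = fst w" "poly p2 (snd l) = snd w"
    using lim uh vh LIMSEQ_unique unfolding z by blast+
  have "continuous_on UNIV (\<lambda>x. cmod (feval x G) ^ ?N)"
    by (intro continuous_intros)
  then have c1: "(\<lambda>n. cmod (feval (z (h n)) G) ^ ?N) \<longlonglongrightarrow> cmod (feval l G) ^ ?N"
    using l by (auto intro: continuous_on_tendsto_compose simp: o_def)
  have "continuous_on UNIV (\<lambda>x. cmod (det (mmat x G)))"
    by (intro continuous_intros)
  moreover have "(\<lambda>n. (u (h n), v (h n))) \<longlonglongrightarrow> w"
    using tendsto_Pair[OF uh vh] by simp
  ultimately have c2: "(\<lambda>n. cmod (det (mmat (u (h n), v (h n)) G))) \<longlonglongrightarrow> cmod (det (mmat w G))"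
    by (auto intro: continuous_on_tendsto_compose)
  have "cmod (feval l G) ^ ?N \<le> cmod (det (mmat w G))"
    by (rule LIMSEQ_le[OF c1 c2]) (use z(3) in blast)
  then have "cmod (feval l G) ^ ?N = 0"
    using assms by (intro antisym) simp_all
  then have "feval l G = 0" by simp
  with p show ?thesis using that by blast
qed

end

section \<open>Point characters and invertible elements\<close>

locale multicentric_algebra = simple_roots_pair p1 p2 lam mu
  for p1 p2 :: "complex poly"
    and lam :: "'d1::finite \<Rightarrow> complex" and mu :: "'d2::finite \<Rightarrow> complex" +
  fixes M1 M2 :: "complex set"
begin

abbreviation M where "M \<equiv> M1 \<times> M2"
abbreviation K where "K \<equiv> (poly p1 -` M1) \<times> (poly p2 -` M2)"
abbreviation X where "X \<equiv> polyproduct_algebra p1 p2 lam mu M1 M2"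
abbreviation ch where "ch \<equiv> point_character p1 p2 lam mu M1 M2"
abbreviation proj :: "complex \<times> complex \<Rightarrow> complex \<times> complex" where
  "proj z \<equiv> (poly p1 (fst z), poly p2 (snd z))"

section \<open>The operations of \<open>X\<close> as pointwise operations\<close>

lemma carrier_X: "carrier X = {f \<in> extensional M. continuous_on M f}"
  by (simp add: polyproduct_algebra_def cont_functions_def)

lemma X_simps:
  "f \<otimes>\<^bsub>X\<^esub> g = (\<lambda>w\<in>M. fprod w (f w) (g w))"
  "f \<oplus>\<^bsub>X\<^esub> g = (\<lambda>w\<in>M. f w + g w)"
  "c \<odot>\<^bsub>X\<^esub> f = (\<lambda>w\<in>M. \<chi> j k. c * f w $ j $ k)"
  "\<one>\<^bsub>X\<^esub> = (\<lambda>w\<in>M. \<chi> j k. 1)"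
  "\<zero>\<^bsub>X\<^esub> = (\<lambda>w\<in>M. 0)"
  by (simp_all add: polyproduct_algebra_def fun_eq_iff polyproduct_eq_fiber_product)

lemma restrict_in_carrier: "continuous_on M f \<Longrightarrow> restrict f M \<in> carrier X"
  by (simp add: carrier_X cong: continuous_on_cong)

lemma continuous_carrier: "f \<in> carrier X \<Longrightarrow> continuous_on M f"
  by (simp add: carrier_X)

lemma restrict_carrier: "f \<in> carrier X \<Longrightarrow> restrict f M = f"
  by (simp add: carrier_X extensional_restrict)

lemma one_closed: "\<one>\<^bsub>X\<^esub> \<in> carrier X"
  unfolding X_simps by (intro restrict_in_carrier continuous_intros)

text \<open>The subtraction in \<open>spectrum\<close> goes through an abstract additive inverse;
  uniqueness of inverses in an abelian group identifies it with the pointwise one.\<close>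

lemma abelian_group_X: "abelian_group X"
proof (rule abelian_groupI)
  fix f g h assume f: "f \<in> carrier X" and g: "g \<in> carrier X" and h: "h \<in> carrier X"
  show "f \<oplus>\<^bsub>X\<^esub> g \<in> carrier X"
    unfolding X_simps by (intro restrict_in_carrier continuous_intros continuous_carrier f g)
  show "(f \<oplus>\<^bsub>X\<^esub> g) \<oplus>\<^bsub>X\<^esub> h = f \<oplus>\<^bsub>X\<^esub> (g \<oplus>\<^bsub>X\<^esub> h)" "f \<oplus>\<^bsub>X\<^esub> g = g \<oplus>\<^bsub>X\<^esub> f"
    unfolding X_simps by (auto simp: restrict_def add_ac)
  show "\<zero>\<^bsub>X\<^esub> \<oplus>\<^bsub>X\<^esub> f = f"
    unfolding X_simps by (rule trans[OF _ restrict_carrier[OF f]]) auto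
  have "(\<lambda>w\<in>M. - f w) \<in> carrier X"
    by (intro restrict_in_carrier continuous_intros continuous_carrier f)
  moreover have "(\<lambda>w\<in>M. - f w) \<oplus>\<^bsub>X\<^esub> f = \<zero>\<^bsub>X\<^esub>"
    unfolding X_simps by (auto simp: restrict_def)
  ultimately show "\<exists>g\<in>carrier X. g \<oplus>\<^bsub>X\<^esub> f = \<zero>\<^bsub>X\<^esub>" by blast
next
  show "\<zero>\<^bsub>X\<^esub> \<in> carrier X"
    unfolding X_simps by (intro restrict_in_carrier continuous_intros)
qed

lemma minus_scalar:
  "f \<ominus>\<^bsub>X\<^esub> (c \<odot>\<^bsub>X\<^esub> \<one>\<^bsub>X\<^esub>) = (\<lambda>w\<in>M. f w - (\<chi> j k. c))"
proof -
  let ?c = "c \<odot>\<^bsub>X\<^esub> \<one>\<^bsub>X\<^esub>"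
  have c: "?c = (\<lambda>w\<in>M. \<chi> j k. c)"
    unfolding X_simps by (auto simp: restrict_def)
  have "\<ominus>\<^bsub>X\<^esub> ?c = (\<lambda>w\<in>M. - (\<chi> j k. c))"
  proof (rule abelian_group.minus_equality[OF abelian_group_X])
    show "(\<lambda>w\<in>M. - (\<chi> j k. c)) \<oplus>\<^bsub>X\<^esub> ?c = \<zero>\<^bsub>X\<^esub>"
      unfolding c unfolding X_simps by (auto simp: restrict_def)
    show "?c \<in> carrier X" "(\<lambda>w\<in>M. - (\<chi> j k. c)) \<in> carrier X"
      unfolding c by (intro restrict_in_carrier continuous_intros)+
  qed
  then show ?thesis
    unfolding a_minus_def X_simps(2) by (auto simp: restrict_def)
qed

section \<open>Characters given by points, units and spectrum\<close>

lemma mem_K: "z \<in> K \<longleftrightarrow> proj z \<in> M"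
  by (auto simp: mem_Times_iff)

lemma ch_eq: "f \<in> carrier X \<Longrightarrow> ch z f = feval z (f (proj z))"
  by (simp add: point_character_def multicentric_sum_eq_fiber_eval)

lemma feval_const: "feval z (\<chi> j k. c) = c"
  by (simp add: fiber_eval_altdef sum_distrib_right[symmetric] A.sum_lagr B.sum_lagr)

lemma feval_row: "feval z (\<chi> j k. x j) = (\<Sum>j\<in>UNIV. x j * A.lagr j (fst z))"
  by (simp add: fiber_eval_altdef sum_distrib_right[symmetric] B.sum_lagr)
    (simp add: mult.commute)

lemma feval_column: "feval z (\<chi> j k. x k) = (\<Sum>k\<in>UNIV. x k * B.lagr k (snd z))"
  by (simp add: fiber_eval_altdef sum_distrib_right[symmetric] A.sum_lagr mult.commute)

lemma feval_add: "feval z (F + G) = feval z F + feval z G"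
  by (simp add: fiber_eval_altdef distrib_left sum.distrib)

lemma feval_diff: "feval z (F - G) = feval z F - feval z G"
  using feval_add[of z "F - G" G] by simp

lemma feval_scale: "feval z (\<chi> j k. c * F $ j $ k) = c * feval z F"
  by (simp add: fiber_eval_altdef sum_distrib_left mult_ac)

lemma point_character_in_characters:
  assumes "z \<in> K"
  shows "ch z \<in> characters X"
proof -
  have w: "proj z \<in> M" using assms mem_K by blast
  have add: "f \<oplus>\<^bsub>X\<^esub> g \<in> carrier X" if "f \<in> carrier X" "g \<in> carrier X" for f g
    unfolding X_simps by (intro restrict_in_carrier continuous_intros continuous_carrier that)
  have mult: "f \<otimes>\<^bsub>X\<^esub> g \<in> carrier X" if "f \<in> carrier X" "g \<in> carrier X" for f g
    unfolding X_simps by (intro restrict_in_carrier continuous_intros continuous_carrier that)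
  have smult: "c \<odot>\<^bsub>X\<^esub> f \<in> carrier X" if "f \<in> carrier X" for f c
    unfolding X_simps by (intro restrict_in_carrier continuous_intros continuous_carrier that)
  have "ch z \<one>\<^bsub>X\<^esub> = 1"
    using w one_closed by (simp add: ch_eq X_simps feval_const)
  then have "\<exists>f\<in>carrier X. ch z f \<noteq> 0"
    using one_closed by force
  moreover have "ch z \<in> extensional (carrier X)"
    by (simp add: point_character_def)
  ultimately show ?thesis
    using w unfolding characters_def
    by (auto simp: ch_eq add mult smult) (auto simp: X_simps feval_add feval_scale fiber_eval_product)
qed

text \<open>By \<open>identity_expansion\<close>, \<open>f\<close> and \<open>g\<close> represent
  the two coordinate functions, so a point character takes the coordinates of its point as values on
  them.\<close>

lemma point_character_inj: "inj_on ch K"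
proof (rule inj_onI)
  fix z z' assume z: "z \<in> K" "z' \<in> K" and eq: "ch z = ch z'"
  define f :: "complex \<times> complex \<Rightarrow> complex^'d2^'d1" where
    "f = (\<lambda>w\<in>M. \<chi> j k. lam j + A.dp_inverse_sum * fst w)"
  define g :: "complex \<times> complex \<Rightarrow> complex^'d2^'d1" where
    "g = (\<lambda>w\<in>M. \<chi> j k. mu k + B.dp_inverse_sum * snd w)"
  have fg: "f \<in> carrier X" "g \<in> carrier X"
    unfolding f_def g_def by (intro restrict_in_carrier continuous_intros)+
  have "ch x f = fst x" "ch x g = snd x" if "x \<in> K" for x
  proof -
    have x: "proj x \<in> M" using that mem_K by blast
    have "ch x f = (\<Sum>j\<in>UNIV. (lam j + A.dp_inverse_sum * poly p1 (fst x)) * A.lagr j (fst x))"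
      using x fg by (simp add: ch_eq f_def feval_row)
    also have "\<dots> = (\<Sum>j\<in>UNIV. lam j * A.lagr j (fst x)) + A.dp_inverse_sum * poly p1 (fst x)"
      by (simp add: distrib_right sum.distrib sum_distrib_left[symmetric] A.sum_lagr)
    finally show "ch x f = fst x"
      using A.identity_expansion[of "fst x"] by simp
    have "ch x g = (\<Sum>k\<in>UNIV. (mu k + B.dp_inverse_sum * poly p2 (snd x)) * B.lagr k (snd x))"
      using x fg by (simp add: ch_eq g_def feval_column)
    also have "\<dots> = (\<Sum>k\<in>UNIV. mu k * B.lagr k (snd x)) + B.dp_inverse_sum * poly p2 (snd x)"
      by (simp add: distrib_right sum.distrib sum_distrib_left[symmetric] B.sum_lagr)
    finally show "ch x g = snd x"
      using B.identity_expansion[of "snd x"] by simp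
  qed
  with z eq show "z = z'"
    by (metis prod_eqI)
qed

lemma Units_iff:
  assumes g: "g \<in> carrier X"
  shows "g \<in> Units X \<longleftrightarrow> (\<forall>z\<in>K. ch z g \<noteq> 0)"
proof
  assume "g \<in> Units X"
  then obtain h where h: "h \<in> carrier X" "h \<otimes>\<^bsub>X\<^esub> g = \<one>\<^bsub>X\<^esub>"
    by (auto simp: Units_def)
  show "\<forall>z\<in>K. ch z g \<noteq> 0"
  proof
    fix z assume "z \<in> K"
    then have w: "proj z \<in> M" using mem_K by blast
    have "fprod (proj z) (h (proj z)) (g (proj z)) = (\<chi> j k. 1)"
      using fun_cong[OF h(2), of "proj z"] w by (simp add: X_simps)
    then have "feval z (h (proj z)) * feval z (g (proj z)) = 1"
      unfolding fiber_eval_product[symmetric] by (simp add: feval_const)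
    then show "ch z g \<noteq> 0"
      using g by (auto simp: ch_eq)
  qed
next
  assume nz: "\<forall>z\<in>K. ch z g \<noteq> 0"
  define A where "A w = mmat w (g w)" for w
  \<comment> \<open>A zero determinant over \<open>w\<close> yields a point above \<open>w\<close>
    at which \<open>g\<close> vanishes; it lies in \<open>K\<close> because \<open>w\<close> lies in
    \<open>M\<close>.\<close>
  have det: "det (A w) \<noteq> 0" if "w \<in> M" for w
  proof
    assume "det (A w) = 0"
    then obtain z where z: "poly p1 (fst z) = fst w" "poly p2 (snd z) = snd w" "feval z (g w) = 0"
      unfolding A_def by (rule det_mult_matrix_zero)
    then have "proj z = w" by simp
    then show False
      using nz z(3) that g mem_K[of z] by (auto simp: ch_eq)
  qed
  define b :: "complex^('d1 \<times> 'd2)" where "b = (\<chi> a. 1)"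
  \<comment> \<open>Cramer's solution of \<open>A w *v x = b\<close>, where \<open>b\<close> is the
    flattened unit. The explicit quotient of determinants makes continuity in \<open>w\<close>
    visible.\<close>
  define h where
    "h = (\<lambda>w\<in>M. unflatten (\<chi> a. det (\<chi> i j. if j = a then b $ i else A w $ i $ j) / det (A w)))"
  have cA: "continuous_on M A"
    unfolding A_def by (intro continuous_intros continuous_carrier g)
  have "continuous_on M (\<lambda>w. if j = a then b $ i else A w $ i $ j)" for a i j
    using cA by (cases "j = a") (auto intro!: continuous_intros)
  then have h: "h \<in> carrier X"
    unfolding h_def unflatten_def
    by (intro restrict_in_carrier continuous_intros cA) (auto simp: det)
  have "fprod w (g w) (h w) = (\<chi> j k. 1)" if "w \<in> M" for w
  proof -
    have "flatten (h w) = (\<chi> a. det (\<chi> i j. if j = a then b $ i else A w $ i $ j) / det (A w))"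
      using that by (simp add: h_def)
    then have "A w *v flatten (h w) = b"
      by (simp only: cramer[OF det[OF that]])
    then have "flatten (fprod w (g w) (h w)) = b"
      unfolding A_def mult_matrix_vector by simp
    then have "fprod w (g w) (h w) = unflatten b"
      by (metis unflatten_flatten)
    then show ?thesis
      by (simp add: b_def unflatten_def)
  qed
  then have "g \<otimes>\<^bsub>X\<^esub> h = \<one>\<^bsub>X\<^esub>"
    unfolding X_simps by (auto simp: restrict_def)
  moreover have "h \<otimes>\<^bsub>X\<^esub> g = g \<otimes>\<^bsub>X\<^esub> h"
    unfolding X_simps by (simp add: fiber_product_commute)
  ultimately show "g \<in> Units X"
    using g h by (auto simp: Units_def)
qed

lemma spectrum_eq:
  assumes f: "f \<in> carrier X"
  shows "spectrum X f = (\<lambda>z. ch z f) ` K"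
proof -
  have "f \<ominus>\<^bsub>X\<^esub> (c \<odot>\<^bsub>X\<^esub> \<one>\<^bsub>X\<^esub>) \<notin> Units X \<longleftrightarrow> (\<exists>z\<in>K. ch z f = c)" for c
  proof -
    let ?g = "\<lambda>w\<in>M. f w - (\<chi> j k. c)"
    have g: "?g \<in> carrier X"
      by (intro restrict_in_carrier continuous_intros continuous_carrier f)
    have "ch z ?g = ch z f - c" if "z \<in> K" for z
    proof -
      have "proj z \<in> M" using that mem_K by blast
      then show ?thesis
        using f g by (simp add: ch_eq feval_diff feval_const)
    qed
    then show ?thesis
      unfolding minus_scalar Units_iff[OF g] by auto
  qed
  then show ?thesis
    unfolding spectrum_def by auto
qed

end

section \<open>Characters\<close>

text \<open>This is the correction term of the one-variable product for the unit vectors at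
  \<open>j\<close> and \<open>l\<close>: only \<open>m = l\<close> in row \<open>i = j\<close> and
  \<open>m = j\<close> in row \<open>i = l\<close> contribute.\<close>

lemma sum_if_diff:
  fixes j l i :: "'d::finite"
  assumes "j \<noteq> l"
  shows "(\<Sum>m\<in>UNIV - {i}. s i m * (of_bool (i = j) - of_bool (m = j)) * (of_bool (i = l) - of_bool (m = l)))
    = - (s j l * of_bool (i = j) + s l j * of_bool (i = l) :: complex)"
proof -
  have "(\<Sum>m\<in>UNIV - {i}. s i m * (of_bool (i = j) - of_bool (m = j)) * (of_bool (i = l) - of_bool (m = l)))
      = (\<Sum>m\<in>UNIV. (if m = l then - (s j l * of_bool (i = j)) else 0) +
          (if m = j then - (s l j * of_bool (i = l)) else 0))"
    using assms by (intro sum.mono_neutral_cong_left) auto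
  also have "\<dots> = - (s j l * of_bool (i = j) + s l j * of_bool (i = l))"
    by (simp add: sum.distrib)
  finally show ?thesis .
qed

context multicentric_algebra
begin

section \<open>Scalar functions, row units and column units as generators of
  \<open>X\<close>\<close>

definition scal :: "(complex \<times> complex \<Rightarrow> complex) \<Rightarrow> complex \<times> complex \<Rightarrow> complex^'d2^'d1" where
  "scal h = (\<lambda>w\<in>M. \<chi> j k. h w)"

text \<open>It represents the Lagrange polynomial at \<open>lam j\<close> in the first variable,
  because those in the second variable sum to 1.\<close>

definition row_unit :: "'d1 \<Rightarrow> complex \<times> complex \<Rightarrow> complex^'d2^'d1" where
  "row_unit j = (\<lambda>w\<in>M. \<chi> i k. of_bool (i = j))"

definition column_unit :: "'d2 \<Rightarrow> complex \<times> complex \<Rightarrow> complex^'d2^'d1" where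
  "column_unit k = (\<lambda>w\<in>M. \<chi> j i. of_bool (i = k))"

lemma scal_closed: "continuous_on M h \<Longrightarrow> scal h \<in> carrier X"
  unfolding scal_def by (intro restrict_in_carrier continuous_intros)

lemma row_unit_closed: "row_unit j \<in> carrier X"
  unfolding row_unit_def by (intro restrict_in_carrier continuous_intros)

lemma column_unit_closed: "column_unit k \<in> carrier X"
  unfolding column_unit_def by (intro restrict_in_carrier continuous_intros)

lemma scal_mult: "scal h \<otimes>\<^bsub>X\<^esub> f = (\<lambda>w\<in>M. \<chi> j k. h w * f w $ j $ k)"
  unfolding X_simps scal_def by (auto simp: fiber_product_scalar_left fun_eq_iff)

text \<open>Row units do not vary with the column, so all column differences vanish and the
  one-variable correction \<open>sum_if_diff\<close> remains.\<close>

lemma row_unit_mult_row_unit: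
  assumes "j \<noteq> l"
  shows "row_unit j \<otimes>\<^bsub>X\<^esub> row_unit l = scal fst \<otimes>\<^bsub>X\<^esub>
    (sigma_coeff p1 lam j l \<odot>\<^bsub>X\<^esub> row_unit j \<oplus>\<^bsub>X\<^esub> sigma_coeff p1 lam l j \<odot>\<^bsub>X\<^esub> row_unit l)"
  unfolding scal_mult unfolding X_simps row_unit_def
  using assms by (auto simp: fun_eq_iff vec_eq_iff fiber_product_nth sum_if_diff)

lemma column_unit_mult_column_unit:
  assumes "k \<noteq> m"
  shows "column_unit k \<otimes>\<^bsub>X\<^esub> column_unit m = scal snd \<otimes>\<^bsub>X\<^esub>
    (sigma_coeff p2 mu k m \<odot>\<^bsub>X\<^esub> column_unit k \<oplus>\<^bsub>X\<^esub> sigma_coeff p2 mu m k \<odot>\<^bsub>X\<^esub> column_unit m)"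
  unfolding scal_mult unfolding X_simps column_unit_def
  using assms by (auto simp: fun_eq_iff vec_eq_iff fiber_product_nth sum_if_diff)

text \<open>Every correction term has a vanishing factor, so the product is entrywise and gives a
  matrix unit.\<close>

lemma row_unit_mult_column_unit:
  "row_unit j \<otimes>\<^bsub>X\<^esub> column_unit k = (\<lambda>w\<in>M. \<chi> i m. of_bool (i = j) * of_bool (m = k))"
  unfolding X_simps row_unit_def column_unit_def
  by (auto simp: fun_eq_iff vec_eq_iff fiber_product_nth)

text \<open>A multiplicative functional is thereby determined by its values on scalar functions, row
  units and column units.\<close>

lemma carrier_expansion:
  assumes "f \<in> carrier X"
  shows "f = (\<lambda>w\<in>M. \<Sum>(j, k)\<in>UNIV. (scal (\<lambda>w. f w $ j $ k) \<otimes>\<^bsub>X\<^esub> (row_unit j \<otimes>\<^bsub>X\<^esub> column_unit k)) w)"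
proof -
  have "(\<Sum>(j, k)\<in>UNIV. (scal (\<lambda>w. f w $ j $ k) \<otimes>\<^bsub>X\<^esub> (row_unit j \<otimes>\<^bsub>X\<^esub> column_unit k)) w) = f w"
    if "w \<in> M" for w
  proof -
    have "(\<Sum>(j, k)\<in>UNIV. f w $ j $ k * (of_bool (i = j) * of_bool (m = k))) = f w $ i $ m" for i m
    proof -
      have "(\<Sum>(j, k)\<in>UNIV. f w $ j $ k * (of_bool (i = j) * of_bool (m = k))) =
          (\<Sum>a\<in>UNIV. if a = (i, m) then f w $ i $ m else 0)"
        by (intro sum.cong refl) auto
      then show ?thesis by simp
    qed
    then show ?thesis
      using that by (simp add: vec_eq_iff scal_mult row_unit_mult_column_unit split_beta)
  qed
  then show ?thesis
    by (intro trans[OF restrict_carrier[OF assms, symmetric]] restrict_ext) simp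
qed

section \<open>Every character is evaluation at a point\<close>

context
  fixes \<eta> assumes char: "\<eta> \<in> characters X"
begin

lemma char_add: "f \<in> carrier X \<Longrightarrow> g \<in> carrier X \<Longrightarrow> \<eta> (f \<oplus>\<^bsub>X\<^esub> g) = \<eta> f + \<eta> g"
  and char_smult: "f \<in> carrier X \<Longrightarrow> \<eta> (c \<odot>\<^bsub>X\<^esub> f) = c * \<eta> f"
  and char_mult: "f \<in> carrier X \<Longrightarrow> g \<in> carrier X \<Longrightarrow> \<eta> (f \<otimes>\<^bsub>X\<^esub> g) = \<eta> f * \<eta> g"
  using char by (simp_all add: characters_def)

lemma char_one: "\<eta> \<one>\<^bsub>X\<^esub> = 1"
proof -
  obtain f where f: "f \<in> carrier X" "\<eta> f \<noteq> 0"
    using char by (auto simp: characters_def)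
  have "\<one>\<^bsub>X\<^esub> \<otimes>\<^bsub>X\<^esub> f = f"
    unfolding X_simps
    by (rule trans[OF _ restrict_carrier[OF f(1)]]) (auto simp: fiber_product_scalar_left vec_eq_iff)
  then have "\<eta> \<one>\<^bsub>X\<^esub> * \<eta> f = \<eta> f"
    using char_mult[OF one_closed f(1)] by simp
  then show ?thesis using f(2) by simp
qed

lemma char_sum:
  assumes "finite S" "\<And>a. a \<in> S \<Longrightarrow> g a \<in> carrier X"
  shows "\<eta> (\<lambda>w\<in>M. \<Sum>a\<in>S. g a w) = (\<Sum>a\<in>S. \<eta> (g a))"
  using assms
proof (induction S rule: finite_induct)
  case empty
  \<comment> \<open>The definition of characters has no clause for zero, so the empty sum is written
    as 0 times the unit.\<close>
  have "(\<lambda>w\<in>M. \<Sum>a\<in>{}. g a w) = 0 \<odot>\<^bsub>X\<^esub> \<one>\<^bsub>X\<^esub>"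
    unfolding X_simps by (auto simp: fun_eq_iff vec_eq_iff)
  then show ?case
    using char_smult[OF one_closed] by simp
next
  case (insert a S)
  let ?r = "\<lambda>w\<in>M. \<Sum>a\<in>S. g a w"
  have "(\<lambda>w\<in>M. \<Sum>a\<in>insert a S. g a w) = g a \<oplus>\<^bsub>X\<^esub> ?r"
    unfolding X_simps using insert.hyps by (auto simp: fun_eq_iff)
  moreover have "?r \<in> carrier X"
    using insert.prems by (intro restrict_in_carrier continuous_intros continuous_carrier) auto
  ultimately have "\<eta> (\<lambda>w\<in>M. \<Sum>a\<in>insert a S. g a w) = \<eta> (g a) + \<eta> ?r"
    using insert.prems by (simp only: char_add insertI1)
  also have "\<eta> ?r = (\<Sum>a\<in>S. \<eta> (g a))"
    by (rule insert.IH) (rule insert.prems, simp)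
  finally show ?case
    using insert.hyps by simp
qed

lemma char_scal_add:
  assumes "continuous_on M g" "continuous_on M h"
  shows "\<eta> (scal (\<lambda>w. g w + h w)) = \<eta> (scal g) + \<eta> (scal h)"
proof -
  have "scal (\<lambda>w. g w + h w) = scal g \<oplus>\<^bsub>X\<^esub> scal h"
    unfolding X_simps scal_def by (auto simp: fun_eq_iff vec_eq_iff)
  then show ?thesis
    by (simp add: char_add scal_closed assms)
qed

lemma char_scal_mult:
  assumes "continuous_on M g" "continuous_on M h"
  shows "\<eta> (scal (\<lambda>w. g w * h w)) = \<eta> (scal g) * \<eta> (scal h)"
proof -
  have "scal (\<lambda>w. g w * h w) = scal g \<otimes>\<^bsub>X\<^esub> scal h"
    unfolding scal_mult unfolding scal_def by (auto simp: fun_eq_iff vec_eq_iff)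
  then show ?thesis
    by (simp add: char_mult scal_closed assms)
qed

lemma char_scal_const: "\<eta> (scal (\<lambda>_. c)) = c"
proof -
  have "scal (\<lambda>_. c) = c \<odot>\<^bsub>X\<^esub> \<one>\<^bsub>X\<^esub>"
    unfolding X_simps scal_def by (auto simp: fun_eq_iff vec_eq_iff)
  then show ?thesis
    using char_smult[OF one_closed] char_one by simp
qed

text \<open>If no point of \<open>M\<close> worked for \<open>h\<close>, the sum of squared moduli below would be an invertible
  element of \<open>C(M)\<close> in the kernel of \<open>\<eta>\<close>. Including both coordinate functions in the sum makes the
  point independent of \<open>h\<close>.\<close>

lemma char_scal_eval:
  assumes h: "continuous_on M h"
  defines "w \<equiv> (\<eta> (scal fst), \<eta> (scal snd))"
  shows "w \<in> M" "\<eta> (scal h) = h w"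
proof -
  define u where "u h v = h v - \<eta> (scal h)" for h :: "complex \<times> complex \<Rightarrow> complex" and v
  have cu: "continuous_on M (u h)" if "continuous_on M h" for h
    unfolding u_def by (intro continuous_intros that)
  have u0: "\<eta> (scal (u h)) = 0" if "continuous_on M h" for h
  proof -
    have "\<eta> (scal (\<lambda>v. h v + (- \<eta> (scal h)))) = 0"
      using that by (subst char_scal_add) (auto simp: char_scal_const)
    then show ?thesis by (simp add: u_def[abs_def])
  qed
  have cq: "continuous_on M (\<lambda>v. cnj (u h v) * u h v)" if "continuous_on M h" for h
    by (intro continuous_intros cu that)
  \<comment> \<open>The kernel of \<open>\<eta>\<close> is an ideal, so it absorbs the conjugate
    factor.\<close>
  have q0: "\<eta> (scal (\<lambda>v. cnj (u h v) * u h v)) = 0" if "continuous_on M h" for h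
    using that by (subst char_scal_mult) (auto intro!: continuous_intros cu simp: u0)
  have c: "continuous_on M fst" "continuous_on M snd"
    by (intro continuous_intros)+
  define F where "F v = (cnj (u fst v) * u fst v + cnj (u snd v) * u snd v) + cnj (u h v) * u h v" for v
  have cF: "continuous_on M F"
    unfolding F_def by (intro continuous_intros cu c h)
  have F0: "\<eta> (scal F) = 0"
    unfolding F_def by (simp add: char_scal_add q0 cq c h continuous_on_add)
  have F: "F v = complex_of_real ((cmod (u fst v))\<^sup>2 + (cmod (u snd v))\<^sup>2 + (cmod (u h v))\<^sup>2)" for v
    by (simp only: F_def of_real_add complex_norm_square mult.commute)
  have "\<exists>v\<in>M. F v = 0"
  proof (rule ccontr)
    assume "\<not> ?thesis"
    then have nz: "F v \<noteq> 0" if "v \<in> M" for v using that by blast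
    have "scal (\<lambda>v. inverse (F v) * F v) = \<one>\<^bsub>X\<^esub>"
      unfolding X_simps scal_def using nz by (auto simp: fun_eq_iff vec_eq_iff)
    moreover have "\<eta> (scal (\<lambda>v. inverse (F v) * F v)) = 0"
      using nz by (subst char_scal_mult) (auto intro!: continuous_intros cF simp: F0)
    ultimately show False
      using char_one by simp
  qed
  then obtain v where v: "v \<in> M" "F v = 0" by blast
  then have "(cmod (u fst v))\<^sup>2 + (cmod (u snd v))\<^sup>2 + (cmod (u h v))\<^sup>2 = 0"
    unfolding F of_real_eq_0_iff by simp
  then have "u fst v = 0" "u snd v = 0" "u h v = 0"
    by (simp_all add: add_nonneg_eq_0_iff)
  then have "v = w" "\<eta> (scal h) = h v"
    by (auto simp: u_def w_def prod_eq_iff)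
  with v(1) show "w \<in> M" "\<eta> (scal h) = h w" by simp_all
qed

text \<open>On scalar functions \<open>\<eta>\<close> is evaluation at \<open>w\<close>. Applied to
  the product relations of the units, it gives the hypotheses of \<open>lagr_of_relations\<close>,
  which supplies the coordinates \<open>z1\<close> and \<open>z2\<close> above \<open>w\<close>;
  \<open>carrier_expansion\<close> extends the agreement to all of \<open>X\<close>.\<close>

lemma char_eq_point_character: "\<exists>z\<in>K. \<eta> = ch z"
proof -
  define w where "w = (\<eta> (scal fst), \<eta> (scal snd))"
  have c: "continuous_on M fst" "continuous_on M snd"
    by (intro continuous_intros)+
  have w: "w \<in> M"
    unfolding w_def using char_scal_eval(1)[OF c(1)] .
  have scal: "\<eta> (scal h) = h w" if "continuous_on M h" for h
    unfolding w_def using char_scal_eval(2)[OF that] .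
  have smult: "c \<odot>\<^bsub>X\<^esub> f \<in> carrier X" if "f \<in> carrier X" for f c
    unfolding X_simps by (intro restrict_in_carrier continuous_intros continuous_carrier that)
  have add: "f \<oplus>\<^bsub>X\<^esub> g \<in> carrier X" if "f \<in> carrier X" "g \<in> carrier X" for f g
    unfolding X_simps by (intro restrict_in_carrier continuous_intros continuous_carrier that)
  have mult: "f \<otimes>\<^bsub>X\<^esub> g \<in> carrier X" if "f \<in> carrier X" "g \<in> carrier X" for f g
    unfolding X_simps by (intro restrict_in_carrier continuous_intros continuous_carrier that)
  define a where "a j = \<eta> (row_unit j)" for j
  define b where "b k = \<eta> (column_unit k)" for k
  \<comment> \<open>\<open>z1\<close> and \<open>z2\<close> are the values of \<open>\<eta>\<close>
    on the representatives of the coordinate functions.\<close>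
  define z1 where "z1 = (\<Sum>j\<in>UNIV. lam j * a j) + A.dp_inverse_sum * fst w"
  define z2 where "z2 = (\<Sum>k\<in>UNIV. mu k * b k) + B.dp_inverse_sum * snd w"
  have "(\<lambda>w\<in>M. \<Sum>j\<in>UNIV. row_unit j w) = \<one>\<^bsub>X\<^esub>"
    unfolding X_simps row_unit_def by (auto simp: fun_eq_iff vec_eq_iff)
  then have suma: "(\<Sum>j\<in>UNIV. a j) = 1"
    using char_sum[of UNIV row_unit] by (simp add: a_def row_unit_closed char_one)
  have "(\<lambda>w\<in>M. \<Sum>k\<in>UNIV. column_unit k w) = \<one>\<^bsub>X\<^esub>"
    unfolding X_simps column_unit_def by (auto simp: fun_eq_iff vec_eq_iff)
  then have sumb: "(\<Sum>k\<in>UNIV. b k) = 1"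
    using char_sum[of UNIV column_unit] by (simp add: b_def column_unit_closed char_one)
  have proda: "a j * a l = fst w * (sigma_coeff p1 lam j l * a j + sigma_coeff p1 lam l j * a l)"
    if "j \<noteq> l" for j l
    using arg_cong[OF row_unit_mult_row_unit[OF that], of \<eta>]
    by (simp add: char_mult char_add char_smult scal_closed c row_unit_closed add smult scal a_def)
  have prodb: "b k * b m = snd w * (sigma_coeff p2 mu k m * b k + sigma_coeff p2 mu m k * b m)"
    if "k \<noteq> m" for k m
    using arg_cong[OF column_unit_mult_column_unit[OF that], of \<eta>]
    by (simp add: char_mult char_add char_smult scal_closed c column_unit_closed add smult scal b_def)
  have a: "poly p1 z1 = fst w" "\<And>j. a j = A.lagr j z1"
    unfolding z1_def by (rule A.lagr_of_relations[OF suma proda], assumption)+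
  have b: "poly p2 z2 = snd w" "\<And>k. b k = B.lagr k z2"
    unfolding z2_def by (rule B.lagr_of_relations[OF sumb prodb], assumption)+
  have P: "proj (z1, z2) = w"
    using a(1) b(1) by simp
  have eq: "\<eta> f = ch (z1, z2) f" if f: "f \<in> carrier X" for f
  proof -
    let ?g = "\<lambda>(j, k). scal (\<lambda>w. f w $ j $ k) \<otimes>\<^bsub>X\<^esub> (row_unit j \<otimes>\<^bsub>X\<^esub> column_unit k)"
    have cf: "continuous_on M (\<lambda>w. f w $ j $ k)" for j k
      by (intro continuous_intros continuous_carrier f)
    have g: "?g x \<in> carrier X" for x
      by (cases x) (simp add: mult scal_closed cf row_unit_closed column_unit_closed)
    have \<eta>g: "\<eta> (?g (j, k)) = f w $ j $ k * (a j * b k)" for j k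
      by (simp add: char_mult scal_closed cf mult row_unit_closed column_unit_closed scal a_def b_def)
    have "f = (\<lambda>w\<in>M. \<Sum>x\<in>UNIV. ?g x w)"
      using carrier_expansion[OF f] by (simp add: split_beta)
    then have "\<eta> f = \<eta> (\<lambda>w\<in>M. \<Sum>x\<in>UNIV. ?g x w)"
      by (rule arg_cong)
    also have "\<dots> = (\<Sum>x\<in>UNIV. \<eta> (?g x))"
      by (rule char_sum) (simp, rule g)
    also have "\<dots> = (\<Sum>j\<in>UNIV. \<Sum>k\<in>UNIV. f w $ j $ k * (a j * b k))"
      unfolding sum_UNIV_prod \<eta>g ..
    also have "\<dots> = feval (z1, z2) (f w)"
      by (simp add: fiber_eval_altdef a(2) b(2) sum_distrib_left mult_ac)
    finally show ?thesis
      using f P by (simp add: ch_eq)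
  qed
  have "\<eta> \<in> extensional (carrier X)" "ch (z1, z2) \<in> extensional (carrier X)"
    using char by (simp_all add: characters_def point_character_def)
  then have "\<eta> = ch (z1, z2)"
    by (rule extensionalityI) (rule eq)
  moreover have "(z1, z2) \<in> K"
    unfolding mem_K P by (rule w)
  ultimately show ?thesis by blast
qed

end

lemma point_character_bij: "bij_betw ch K (characters X)"
  unfolding bij_betw_def
  using point_character_inj point_character_in_characters char_eq_point_character by blast

end

theorem mainTheorem4:
  fixes p1 p2 :: "complex poly"
    and lam :: "'d1::finite \<Rightarrow> complex" and mu :: "'d2::finite \<Rightarrow> complex"
    and M1 M2 K1 K2 :: "complex set"
    and X :: "(complex \<times> complex \<Rightarrow> complex^'d2^'d1) normed_algebra"
    and ch :: "complex \<times> complex \<Rightarrow> (complex \<times> complex \<Rightarrow> complex^'d2^'d1) \<Rightarrow> complex"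
  assumes "lead_coeff p1 = 1" and "degree p1 = CARD('d1)"
    and "inj lam" and "{z. poly p1 z = 0} = range lam"
    and "lead_coeff p2 = 1" and "degree p2 = CARD('d2)"
    and "inj mu" and "{z. poly p2 z = 0} = range mu"
    and "compact M1" and "compact M2"
    and "K1 = poly p1 -` M1" and "K2 = poly p2 -` M2"
    and "X = polyproduct_algebra p1 p2 lam mu M1 M2"
    and "ch = point_character p1 p2 lam mu M1 M2"
  shows "bij_betw ch (K1 \<times> K2) (characters X) \<and>
    (\<forall>f\<in>carrier X.
       (\<lambda>z\<in>K1 \<times> K2. gelfand_transform X f (ch z)) = multicentric_rep p1 p2 lam mu M1 M2 f \<and>
       spectrum X f = {gelfand_transform X f (ch (z1, z2)) | z1 z2. (z1, z2) \<in> K1 \<times> K2})"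
proof -
  interpret multicentric_algebra p1 p2 lam mu M1 M2
    using assms by unfold_locales
  \<comment> \<open>The transform is restricted to the characters, so its value at
    \<open>ch z\<close> is meaningful only once \<open>ch z\<close> is known to be one.\<close>
  have gelfand: "gelfand_transform X f (ch z) = ch z f" if "z \<in> K1 \<times> K2" for f z
    using point_character_in_characters[of z] that assms by (simp add: gelfand_transform_def)
  have "(\<lambda>z\<in>K1 \<times> K2. gelfand_transform X f (ch z)) = multicentric_rep p1 p2 lam mu M1 M2 f"
    if "f \<in> carrier X" for f
  proof -
    have "(\<lambda>z\<in>K1 \<times> K2. gelfand_transform X f (ch z)) = (\<lambda>z\<in>K1 \<times> K2. ch z f)"
      by (intro restrict_ext gelfand)
    then show ?thesis
      using that by (simp add: multicentric_rep_def point_character_def assms restrict_def fun_eq_iff)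
  qed
  moreover have "spectrum X f = {gelfand_transform X f (ch (z1, z2)) | z1 z2. (z1, z2) \<in> K1 \<times> K2}"
    if "f \<in> carrier X" for f
  proof -
    have "spectrum X f = (\<lambda>z. ch z f) ` (K1 \<times> K2)"
      using spectrum_eq that assms by simp
    also have "\<dots> = (\<lambda>z. gelfand_transform X f (ch z)) ` (K1 \<times> K2)"
      by (intro image_cong refl gelfand[symmetric])
    finally show ?thesis by (auto simp: image_def)
  qed
  moreover have "bij_betw ch (K1 \<times> K2) (characters X)"
    using point_character_bij assms by simp
  ultimately show ?thesis by blast
qed

end
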